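(* Let $\mathcal B$ be an abelian category with enough projectives, and let $\lambda$ be an integer-valued function on the objects of $\mathcal B$ that is invariant under isomorphisms and additive on short exact sequences (i.e. $\lambda(Y)=\lambda(X)+\lambda(Z)$ for every short exact sequence $0\to X\to Y\to Z\to 0$ in $\mathcal B$). Suppose that $\lambda(P)=0$ for every projective object $P$ of $\mathcal B$, and that $\lambda(S)>0$ for some object $S\in\mathcal B$. Let $\mathcal A=\{M\in\mathcal B\mid \lambda(M)\ge 0\}$, regarded as a full subcategory of $\mathcal B$ and endowed with the exact structure induced from $\mathcal B$, and let $\mathcal P=\operatorname{Proj}(\mathcal A)$ be the full subcategory of projective objects of the exact category $\mathcal A$. Then: (i) $(\mathcal I(\mathcal P),\mathcal I(\mathcal A))$ is a complete ideal cotorsion pair in $\mathcal A$, and both $\mathcal I(\mathcal P)$ and $\mathcal I(\mathcal A)$ are object ideals; (ii) $(\operatorname{Ob}(\mathcal I(\mathcal P)),\operatorname{Ob}(\mathcal I(\mathcal A)))=(\mathcal P,\mathcal A)$, and the cotorsion pair $(\mathcal P,\mathcal A)$ is not complete; (iii) $\mathcal A$ is not weakly idempotent complete.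
   Context: Induced exact structure: the conflations of $\mathcal A$ are the short exact sequences $0\to X\to Y\to Z\to 0$ of $\mathcal B$ with $X,Y,Z\in\mathcal A$. An object of an exact category is projective if it is projective with respect to conflations. $\operatorname{Ext}$ denotes the group $\operatorname{Ext}^1$ of equivalence classes of conflations in the exact category under consideration. An exact (or additive) category is weakly idempotent complete if every retraction (split epimorphism) has a kernel. Let $\mathcal A$ be an exact category. Cotorsion pairs. For a full subcategory $\mathcal C\subseteq\mathcal A$ put ${}^{\perp}\mathcal C=\{F\in\mathcal A\mid \operatorname{Ext}(F,C)=0 \text{ for every } C\in\mathcal C\}$, and for a full subcategory $\mathcal F$ put $\mathcal F^{\perp}=\{C\in\mathcal A\mid \operatorname{Ext}(F,C)=0\text{ for every }F\in\mathcal F\}$. A pair $(\mathcal F,\mathcal C)$ of full subcategories is a cotorsion pair if $\mathcal F={}^{\perp}\mathcal C$ and $\mathcal C=\mathcal F^{\perp}$. It is special precovering if every object $A\in\mathcal A$ occurs in a conflation $C\to F\to A$ with $F\in\mathcal F$ and $C\in\mathcal C$; it is special preenveloping if every $A\in\mathcal A$ occurs in a conflation $A\to C'\to F'$ with $C'\in\mathcal C$ and $F'\in\mathcal F$. It is complete if both of these conditions hold. Ideals. An ideal of $\mathcal A$ is a two-sided ideal of morphisms (a class of morphisms closed under addition of parallel morphisms, containing zero morphisms, and closed under composition on either side with arbitrary morphisms). For a full additive subcategory $\mathcal X$ of $\mathcal A$, $\mathcal I(\mathcal X)$ denotes the ideal of all morphisms of $\mathcal A$ that factor through an object of $\mathcal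 X$. For an ideal $\mathcal I$, put $\operatorname{Ob}(\mathcal I)=\{X\in\mathcal A\mid 1_X\in\mathcal I\}$, viewed as a full subcategory. $\mathcal I$ is an object ideal if $\mathcal I=\mathcal I(\operatorname{Ob}(\mathcal I))$; equivalently, $\mathcal I=\mathcal I(\mathcal X)$ for some full additive subcategory $\mathcal X$. Ideal cotorsion pairs. For morphisms $i:A\to B$ and $j:X\to Y$, $\operatorname{Ext}(i,j)=j_*i^*:\operatorname{Ext}(B,X)\to\operatorname{Ext}(A,Y)$ is the homomorphism obtained by pullback along $i$ and pushout along $j$. For an ideal $\mathcal J$, ${}^{\perp}\mathcal J$ is the ideal of morphisms $i$ with $\operatorname{Ext}(i,j)=0$ for every $j\in\mathcal J$; for an ideal $\mathcal I$, $\mathcal I^{\perp}$ is the ideal of morphisms $j$ with $\operatorname{Ext}(i,j)=0$ for every $i\in\mathcal I$. A pair $(\mathcal I,\mathcal J)$ of ideals is an ideal cotorsion pair if $\mathcal I={}^{\perp}\mathcal J$ and $\mathcal J=\mathcal I^{\perp}$. Special approximations by ideals (in the sense of the ideal approximation theory of Fu, Guil Asensio, Herzog and Torrecillas). A special $\mathcal I$-precover of an object $A$ is a morphism $i:X\to A$ in $\mathcal I$ that is the deflation of a conflation $B\to X\xrightarrow{i}A$ which is the pushout of some conflation $Y\to Z\to A$ along a morphism $j:Y\to B$ with $j\in\mathcal I^{\perp}$. Dually, a special $\mathcal J$-preenvelope of $A$ is a morphism $e:A\to X$ in $\mathcal J$ that is the inflation of a conflation $A\xrightarrow{e}X\to B$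 which is the pullback of some conflation $A\to Z\to Y$ along a morphism $i:B\to Y$ with $i\in{}^{\perp}\mathcal J$. The ideal $\mathcal I$ is special precovering if every object of $\mathcal A$ has a special $\mathcal I$-precover, and $\mathcal J$ is special preenveloping if every object of $\mathcal A$ has a special $\mathcal J$-preenvelope. An ideal cotorsion pair $(\mathcal I,\mathcal J)$ is complete if $\mathcal I$ is special precovering and $\mathcal J$ is special preenveloping. If $(\mathcal I,\mathcal J)$ is an ideal cotorsion pair with both $\mathcal I$ and $\mathcal J$ object ideals, then $(\operatorname{Ob}(\mathcal I),\operatorname{Ob}(\mathcal J))$ is a cotorsion pair. *)

theory Defs
  imports "HOL-Algebra.Group"
begin

section \<open>Preadditive, additive and abelian categories\<close>

text \<open>Every morphism carries its domain and codomain, so that classes of morphisms (ideals)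
  are plain sets. The term \<open>g \<cdot>\<^bsub>C\<^esub> f\<close> is the composite
  "first \<open>f\<close>, then \<open>g\<close>". All operations are relevant only on the carriers.\<close>

record ('o, 'm) precat =
  Obj  :: "'o set"
  Arr  :: "'m set"
  Dom  :: "'m \<Rightarrow> 'o"
  Cod  :: "'m \<Rightarrow> 'o"
  Id   :: "'o \<Rightarrow> 'm"
  Comp :: "'m \<Rightarrow> 'm \<Rightarrow> 'm" (infixr "\<cdot>\<index>" 75)
  Add  :: "'m \<Rightarrow> 'm \<Rightarrow> 'm" (infixl "\<boxplus>\<index>" 65)
  Zero :: "'o \<Rightarrow> 'o \<Rightarrow> 'm"

definition Hom :: "('o, 'm) precat \<Rightarrow> 'o \<Rightarrow> 'o \<Rightarrow> 'm set" where
  "Hom C X Y = {f \<in> Arr C. Dom C f = X \<and> Cod C f = Y}"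

definition hom_group :: "('o, 'm) precat \<Rightarrow> 'o \<Rightarrow> 'o \<Rightarrow> 'm monoid" where
  "hom_group C X Y = \<lparr>carrier = Hom C X Y, mult = Add C, one = Zero C X Y\<rparr>"

locale preadditive_category =
  fixes C :: "('o, 'm) precat" (structure)
  assumes dom_obj: "f \<in> Arr C \<Longrightarrow> Dom C f \<in> Obj C"
    and cod_obj: "f \<in> Arr C \<Longrightarrow> Cod C f \<in> Obj C"
    and id_hom: "X \<in> Obj C \<Longrightarrow> Id C X \<in> Hom C X X"
    and comp_hom: "\<lbrakk>f \<in> Hom C X Y; g \<in> Hom C Y Z\<rbrakk> \<Longrightarrow> g \<cdot> f \<in> Hom C X Z"
    and comp_id_right: "f \<in> Hom C X Y \<Longrightarrow> f \<cdot> Id C X = f"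
    and comp_id_left: "f \<in> Hom C X Y \<Longrightarrow> Id C Y \<cdot> f = f"
    and comp_assoc: "\<lbrakk>f \<in> Hom C W X; g \<in> Hom C X Y; h \<in> Hom C Y Z\<rbrakk>
                      \<Longrightarrow> (h \<cdot> g) \<cdot> f = h \<cdot> (g \<cdot> f)"
    and hom_comm_group: "\<lbrakk>X \<in> Obj C; Y \<in> Obj C\<rbrakk> \<Longrightarrow> comm_group (hom_group C X Y)"
    and comp_add_right: "\<lbrakk>f \<in> Hom C X Y; f' \<in> Hom C X Y; g \<in> Hom C Y Z\<rbrakk>
                      \<Longrightarrow> g \<cdot> (f \<boxplus> f') = (g \<cdot> f) \<boxplus> (g \<cdot> f')"
    and comp_add_left: "\<lbrakk>f \<in> Hom C X Y; g \<in> Hom C Y Z; g' \<in> Hom C Y Z\<rbrakk>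
                      \<Longrightarrow> (g \<boxplus> g') \<cdot> f = (g \<cdot> f) \<boxplus> (g' \<cdot> f)"

definition is_zero_object :: "('o, 'm) precat \<Rightarrow> 'o \<Rightarrow> bool" where
  "is_zero_object C Z \<longleftrightarrow> Z \<in> Obj C \<and>
     (\<forall>X\<in>Obj C. (\<exists>!f. f \<in> Hom C X Z) \<and> (\<exists>!f. f \<in> Hom C Z X))"

text \<open>\<open>S = X \<oplus> Y\<close> with injections \<open>i\<close>, \<open>j\<close> and projections \<open>p\<close>, \<open>q\<close>.\<close>

definition is_biproduct ::
    "('o, 'm) precat \<Rightarrow> 'o \<Rightarrow> 'o \<Rightarrow> 'o \<Rightarrow> 'm \<Rightarrow> 'm \<Rightarrow> 'm \<Rightarrow> 'm \<Rightarrow> bool" where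
  "is_biproduct C X Y S i j p q \<longleftrightarrow>
     i \<in> Hom C X S \<and> j \<in> Hom C Y S \<and> p \<in> Hom C S X \<and> q \<in> Hom C S Y \<and>
     p \<cdot>\<^bsub>C\<^esub> i = Id C X \<and> q \<cdot>\<^bsub>C\<^esub> j = Id C Y \<and>
     p \<cdot>\<^bsub>C\<^esub> j = Zero C Y X \<and> q \<cdot>\<^bsub>C\<^esub> i = Zero C X Y \<and>
     (i \<cdot>\<^bsub>C\<^esub> p) \<boxplus>\<^bsub>C\<^esub> (j \<cdot>\<^bsub>C\<^esub> q) = Id C S"

locale additive_category = preadditive_category +
  assumes zero_object: "\<exists>Z. is_zero_object C Z"
    and biproducts: "\<lbrakk>X \<in> Obj C; Y \<in> Obj C\<rbrakk> \<Longrightarrow> \<exists>S i j p q. is_biproduct C X Y S i j p q"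

definition is_iso :: "('o, 'm) precat \<Rightarrow> 'm \<Rightarrow> bool" where
  "is_iso C f \<longleftrightarrow> f \<in> Arr C \<and>
     (\<exists>g \<in> Hom C (Cod C f) (Dom C f).
        g \<cdot>\<^bsub>C\<^esub> f = Id C (Dom C f) \<and> f \<cdot>\<^bsub>C\<^esub> g = Id C (Cod C f))"

definition isomorphic :: "('o, 'm) precat \<Rightarrow> 'o \<Rightarrow> 'o \<Rightarrow> bool" where
  "isomorphic C X Y \<longleftrightarrow> (\<exists>f \<in> Hom C X Y. is_iso C f)"

definition monic :: "('o, 'm) precat \<Rightarrow> 'm \<Rightarrow> bool" where
  "monic C f \<longleftrightarrow> f \<in> Arr C \<and>
     (\<forall>W\<in>Obj C. \<forall>u\<in>Hom C W (Dom C f). \<forall>v\<in>Hom C W (Dom C f).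
        f \<cdot>\<^bsub>C\<^esub> u = f \<cdot>\<^bsub>C\<^esub> v \<longrightarrow> u = v)"

definition epic :: "('o, 'm) precat \<Rightarrow> 'm \<Rightarrow> bool" where
  "epic C f \<longleftrightarrow> f \<in> Arr C \<and>
     (\<forall>W\<in>Obj C. \<forall>u\<in>Hom C (Cod C f) W. \<forall>v\<in>Hom C (Cod C f) W.
        u \<cdot>\<^bsub>C\<^esub> f = v \<cdot>\<^bsub>C\<^esub> f \<longrightarrow> u = v)"

definition retraction :: "('o, 'm) precat \<Rightarrow> 'm \<Rightarrow> bool" where
  "retraction C r \<longleftrightarrow> r \<in> Arr C \<and>
     (\<exists>s \<in> Hom C (Cod C r) (Dom C r). r \<cdot>\<^bsub>C\<^esub> s = Id C (Cod C r))"

definition is_kernel :: "('o, 'm) precat \<Rightarrow> 'm \<Rightarrow> 'm \<Rightarrow> bool" where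
  "is_kernel C k f \<longleftrightarrow> k \<in> Arr C \<and> f \<in> Arr C \<and> Cod C k = Dom C f \<and>
     f \<cdot>\<^bsub>C\<^esub> k = Zero C (Dom C k) (Cod C f) \<and>
     (\<forall>W\<in>Obj C. \<forall>h\<in>Hom C W (Dom C f). f \<cdot>\<^bsub>C\<^esub> h = Zero C W (Cod C f) \<longrightarrow>
        (\<exists>!u. u \<in> Hom C W (Dom C k) \<and> k \<cdot>\<^bsub>C\<^esub> u = h))"

definition is_cokernel :: "('o, 'm) precat \<Rightarrow> 'm \<Rightarrow> 'm \<Rightarrow> bool" where
  "is_cokernel C c f \<longleftrightarrow> c \<in> Arr C \<and> f \<in> Arr C \<and> Dom C c = Cod C f \<and>
     c \<cdot>\<^bsub>C\<^esub> f = Zero C (Dom C f) (Cod C c) \<and>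
     (\<forall>W\<in>Obj C. \<forall>h\<in>Hom C (Cod C f) W. h \<cdot>\<^bsub>C\<^esub> f = Zero C (Dom C f) W \<longrightarrow>
        (\<exists>!u. u \<in> Hom C (Cod C c) W \<and> u \<cdot>\<^bsub>C\<^esub> c = h))"

locale abelian_category = additive_category +
  assumes has_kernels: "f \<in> Arr C \<Longrightarrow> \<exists>k. is_kernel C k f"
    and has_cokernels: "f \<in> Arr C \<Longrightarrow> \<exists>c. is_cokernel C c f"
    and monic_normal: "monic C f \<Longrightarrow> \<exists>g. is_kernel C f g"
    and epic_normal: "epic C f \<Longrightarrow> \<exists>g. is_cokernel C f g"

text \<open>\<open>(f, g)\<close> is a kernel-cokernel pair; in an abelian category this says that
  \<open>0 \<rightarrow> Dom f \<rightarrow> Cod f \<rightarrow> Cod g \<rightarrow> 0\<close> is a short exact sequence.\<close>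

definition short_exact :: "('o, 'm) precat \<Rightarrow> 'm \<Rightarrow> 'm \<Rightarrow> bool" where
  "short_exact C f g \<longleftrightarrow> is_kernel C f g \<and> is_cokernel C g f"

definition projective :: "('o, 'm) precat \<Rightarrow> 'o \<Rightarrow> bool" where
  "projective C P \<longleftrightarrow> P \<in> Obj C \<and>
     (\<forall>g. epic C g \<longrightarrow> (\<forall>h \<in> Hom C P (Cod C g). \<exists>u \<in> Hom C P (Dom C g). g \<cdot>\<^bsub>C\<^esub> u = h))"

definition enough_projectives :: "('o, 'm) precat \<Rightarrow> bool" where
  "enough_projectives C \<longleftrightarrow>
     (\<forall>X\<in>Obj C. \<exists>P. projective C P \<and> (\<exists>p \<in> Hom C P X. epic C p))"

definition weakly_idempotent_complete :: "('o, 'm) precat \<Rightarrow> bool" where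
  "weakly_idempotent_complete C \<longleftrightarrow> (\<forall>r. retraction C r \<longrightarrow> (\<exists>k. is_kernel C k r))"

text \<open>Full subcategories are given by their sets of objects.\<close>

definition full_subcategory :: "('o, 'm) precat \<Rightarrow> 'o set \<Rightarrow> ('o, 'm) precat" where
  "full_subcategory C S =
     C\<lparr>Obj := Obj C \<inter> S, Arr := {f \<in> Arr C. Dom C f \<in> S \<and> Cod C f \<in> S}\<rparr>"


section \<open>Exact categories\<close>

text \<open>The square with \<open>f : X \<rightarrow> Y\<close>, \<open>a : X \<rightarrow> X'\<close>, \<open>b : Y \<rightarrow> Y'\<close>, \<open>f' : X' \<rightarrow> Y'\<close>
  and \<open>b f = f' a\<close> is a pushout.\<close>

definition is_pushout :: "('o, 'm) precat \<Rightarrow> 'm \<Rightarrow> 'm \<Rightarrow> 'm \<Rightarrow> 'm \<Rightarrow> bool" where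
  "is_pushout C f a b f' \<longleftrightarrow>
     f \<in> Arr C \<and> a \<in> Arr C \<and> b \<in> Arr C \<and> f' \<in> Arr C \<and>
     Dom C f = Dom C a \<and> Dom C b = Cod C f \<and> Dom C f' = Cod C a \<and> Cod C b = Cod C f' \<and>
     b \<cdot>\<^bsub>C\<^esub> f = f' \<cdot>\<^bsub>C\<^esub> a \<and>
     (\<forall>W\<in>Obj C. \<forall>u\<in>Hom C (Cod C f) W. \<forall>v\<in>Hom C (Cod C a) W.
        u \<cdot>\<^bsub>C\<^esub> f = v \<cdot>\<^bsub>C\<^esub> a \<longrightarrow>
        (\<exists>!w. w \<in> Hom C (Cod C b) W \<and> w \<cdot>\<^bsub>C\<^esub> b = u \<and> w \<cdot>\<^bsub>C\<^esub> f' = v))"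

text \<open>The square with \<open>g : Y \<rightarrow> Z\<close>, \<open>a : Z' \<rightarrow> Z\<close>, \<open>b : Y' \<rightarrow> Y\<close>, \<open>g' : Y' \<rightarrow> Z'\<close>
  and \<open>g b = a g'\<close> is a pullback.\<close>

definition is_pullback :: "('o, 'm) precat \<Rightarrow> 'm \<Rightarrow> 'm \<Rightarrow> 'm \<Rightarrow> 'm \<Rightarrow> bool" where
  "is_pullback C g a b g' \<longleftrightarrow>
     g \<in> Arr C \<and> a \<in> Arr C \<and> b \<in> Arr C \<and> g' \<in> Arr C \<and>
     Cod C g = Cod C a \<and> Cod C b = Dom C g \<and> Cod C g' = Dom C a \<and> Dom C b = Dom C g' \<and>
     g \<cdot>\<^bsub>C\<^esub> b = a \<cdot>\<^bsub>C\<^esub> g' \<and>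
     (\<forall>W\<in>Obj C. \<forall>u\<in>Hom C W (Dom C g). \<forall>v\<in>Hom C W (Dom C a).
        g \<cdot>\<^bsub>C\<^esub> u = a \<cdot>\<^bsub>C\<^esub> v \<longrightarrow>
        (\<exists>!w. w \<in> Hom C W (Dom C b) \<and> b \<cdot>\<^bsub>C\<^esub> w = u \<and> g' \<cdot>\<^bsub>C\<^esub> w = v))"

text \<open>A conflation \<open>X \<rightarrow> Y \<rightarrow> Z\<close> is the pair of its inflation and its deflation.\<close>

definition inflation :: "('m \<times> 'm) set \<Rightarrow> 'm \<Rightarrow> bool" where
  "inflation E f \<longleftrightarrow> (\<exists>g. (f, g) \<in> E)"

definition deflation :: "('m \<times> 'm) set \<Rightarrow> 'm \<Rightarrow> bool" where
  "deflation E g \<longleftrightarrow> (\<exists>f. (f, g) \<in> E)"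

locale exact_category = additive_category C for C :: "('o, 'm) precat" (structure) +
  fixes E :: "('m \<times> 'm) set"
  assumes conflation_short_exact: "(f, g) \<in> E \<Longrightarrow> short_exact C f g"
    and conflation_iso: "\<lbrakk>(f, g) \<in> E; f' \<in> Hom C X' Y'; g' \<in> Hom C Y' Z';
          a \<in> Hom C (Dom C f) X'; b \<in> Hom C (Cod C f) Y'; c \<in> Hom C (Cod C g) Z';
          is_iso C a; is_iso C b; is_iso C c; b \<cdot> f = f' \<cdot> a; c \<cdot> g = g' \<cdot> b\<rbrakk>
          \<Longrightarrow> (f', g') \<in> E"
    and id_inflation: "X \<in> Obj C \<Longrightarrow> inflation E (Id C X)"
    and id_deflation: "X \<in> Obj C \<Longrightarrow> deflation E (Id C X)"
    and inflation_comp: "\<lbrakk>inflation E f; inflation E g; Cod C f = Dom C g\<rbrakk>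
          \<Longrightarrow> inflation E (g \<cdot> f)"
    and deflation_comp: "\<lbrakk>deflation E f; deflation E g; Cod C f = Dom C g\<rbrakk>
          \<Longrightarrow> deflation E (g \<cdot> f)"
    and inflation_pushout: "\<lbrakk>inflation E f; a \<in> Arr C; Dom C a = Dom C f\<rbrakk>
          \<Longrightarrow> \<exists>b f'. is_pushout C f a b f' \<and> inflation E f'"
    and deflation_pullback: "\<lbrakk>deflation E g; a \<in> Arr C; Cod C a = Cod C g\<rbrakk>
          \<Longrightarrow> \<exists>b g'. is_pullback C g a b g' \<and> deflation E g'"

definition induced_conflations :: "('o, 'm) precat \<Rightarrow> 'o set \<Rightarrow> ('m \<times> 'm) set" where
  "induced_conflations C S =
     {(f, g). short_exact C f g \<and> Dom C f \<in> S \<and> Cod C f \<in> S \<and> Cod C g \<in> S}"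

definition exact_projectives :: "('o, 'm) precat \<Rightarrow> ('m \<times> 'm) set \<Rightarrow> 'o set" where
  "exact_projectives C E = {P \<in> Obj C.
     \<forall>(f, g)\<in>E. \<forall>h \<in> Hom C P (Cod C g). \<exists>u \<in> Hom C P (Dom C g). g \<cdot>\<^bsub>C\<^esub> u = h}"


section \<open>The bifunctor Ext\<close>

text \<open>Conflations \<open>X \<rightarrow> Y \<rightarrow> Z\<close> with fixed ends \<open>Z\<close> (first) and \<open>X\<close> (second),
  in the order of the arguments of \<open>Ext(Z, X)\<close>.\<close>

definition ext_conflations ::
    "('o, 'm) precat \<Rightarrow> ('m \<times> 'm) set \<Rightarrow> 'o \<Rightarrow> 'o \<Rightarrow> ('m \<times> 'm) set" where
  "ext_conflations C E Z X = {(f, g) \<in> E. Dom C f = X \<and> Cod C g = Z}"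

definition ext_equiv ::
    "('o, 'm) precat \<Rightarrow> ('m \<times> 'm) set \<Rightarrow> 'o \<Rightarrow> 'o \<Rightarrow> (('m \<times> 'm) \<times> ('m \<times> 'm)) set" where
  "ext_equiv C E Z X = {((f, g), (f', g')).
     (f, g) \<in> ext_conflations C E Z X \<and> (f', g') \<in> ext_conflations C E Z X \<and>
     (\<exists>h \<in> Hom C (Cod C f) (Cod C f'). is_iso C h \<and>
        h \<cdot>\<^bsub>C\<^esub> f = f' \<and> g' \<cdot>\<^bsub>C\<^esub> h = g)}"

text \<open>\<open>(f', g')\<close> is the pullback of the conflation \<open>(f, g)\<close> along \<open>a\<close>,
  respectively its pushout along \<open>a\<close>.\<close>

definition conflation_pullback ::
    "('o, 'm) precat \<Rightarrow> ('m \<times> 'm) set \<Rightarrow> 'm \<Rightarrow> ('m \<times> 'm) \<Rightarrow> ('m \<times> 'm) \<Rightarrow> bool" where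
  "conflation_pullback C E a = (\<lambda>(f, g) (f', g').
     (f, g) \<in> E \<and> (f', g') \<in> E \<and> Dom C f' = Dom C f \<and>
     (\<exists>b. is_pullback C g a b g' \<and> b \<cdot>\<^bsub>C\<^esub> f' = f))"

definition conflation_pushout ::
    "('o, 'm) precat \<Rightarrow> ('m \<times> 'm) set \<Rightarrow> 'm \<Rightarrow> ('m \<times> 'm) \<Rightarrow> ('m \<times> 'm) \<Rightarrow> bool" where
  "conflation_pushout C E a = (\<lambda>(f, g) (f', g').
     (f, g) \<in> E \<and> (f', g') \<in> E \<and> Cod C g' = Cod C g \<and>
     (\<exists>b. is_pushout C f a b f' \<and> g' \<cdot>\<^bsub>C\<^esub> b = g))"

text \<open>The maps \<open>i\<^sup>*\<close>, \<open>j\<^sub>*\<close> and \<open>Ext(i, j) = j\<^sub>* i\<^sup>*\<close> on equivalence classes. Pullbacks and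
  pushouts are unique only up to equivalence, so the value on a class collects all of them.\<close>

definition ext_pull ::
    "('o, 'm) precat \<Rightarrow> ('m \<times> 'm) set \<Rightarrow> 'm \<Rightarrow> ('m \<times> 'm) set \<Rightarrow> ('m \<times> 'm) set" where
  "ext_pull C E i \<xi> = {e'. \<exists>e\<in>\<xi>. conflation_pullback C E i e e'}"

definition ext_push ::
    "('o, 'm) precat \<Rightarrow> ('m \<times> 'm) set \<Rightarrow> 'm \<Rightarrow> ('m \<times> 'm) set \<Rightarrow> ('m \<times> 'm) set" where
  "ext_push C E j \<xi> = {e'. \<exists>e\<in>\<xi>. conflation_pushout C E j e e'}"

definition ext_map ::
    "('o, 'm) precat \<Rightarrow> ('m \<times> 'm) set \<Rightarrow> 'm \<Rightarrow> 'm \<Rightarrow> ('m \<times> 'm) set \<Rightarrow> ('m \<times> 'm) set" where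
  "ext_map C E i j \<xi> = ext_push C E j (ext_pull C E i \<xi>)"

text \<open>The class of the direct sum conflations \<open>X \<rightarrow> X \<oplus> Z \<rightarrow> Z\<close>.\<close>

definition ext_zero ::
    "('o, 'm) precat \<Rightarrow> ('m \<times> 'm) set \<Rightarrow> 'o \<Rightarrow> 'o \<Rightarrow> ('m \<times> 'm) set" where
  "ext_zero C E Z X = {(f, g) \<in> ext_conflations C E Z X.
     \<exists>s r. is_biproduct C X Z (Cod C f) f s r g}"

text \<open>The Baer sum \<open>\<nabla>\<^sub>* \<Delta>\<^sup>* (e\<^sub>1 \<oplus> e\<^sub>2)\<close>, with the codiagonal \<open>\<nabla> : X \<oplus> X \<rightarrow> X\<close>
  and the diagonal \<open>\<Delta> : Z \<rightarrow> Z \<oplus> Z\<close>.\<close>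

definition baer_sum ::
    "('o, 'm) precat \<Rightarrow> ('m \<times> 'm) set \<Rightarrow> 'o \<Rightarrow> 'o \<Rightarrow>
     ('m \<times> 'm) set \<Rightarrow> ('m \<times> 'm) set \<Rightarrow> ('m \<times> 'm) set" where
  "baer_sum C E Z X \<xi> \<eta> = {e. \<exists>(f1, g1)\<in>\<xi>. \<exists>(f2, g2)\<in>\<eta>.
     \<exists>XX ix jx px qx. is_biproduct C X X XX ix jx px qx \<and>
     (\<exists>YY iy jy py qy. is_biproduct C (Cod C f1) (Cod C f2) YY iy jy py qy \<and>
     (\<exists>ZZ iz jz pz qz. is_biproduct C Z Z ZZ iz jz pz qz \<and>
        e \<in> ext_map C E (iz \<boxplus>\<^bsub>C\<^esub> jz) (px \<boxplus>\<^bsub>C\<^esub> qx)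
              {((iy \<cdot>\<^bsub>C\<^esub> f1 \<cdot>\<^bsub>C\<^esub> px) \<boxplus>\<^bsub>C\<^esub> (jy \<cdot>\<^bsub>C\<^esub> f2 \<cdot>\<^bsub>C\<^esub> qx),
                (iz \<cdot>\<^bsub>C\<^esub> g1 \<cdot>\<^bsub>C\<^esub> py) \<boxplus>\<^bsub>C\<^esub> (jz \<cdot>\<^bsub>C\<^esub> g2 \<cdot>\<^bsub>C\<^esub> qy))}))}"

definition Ext ::
    "('o, 'm) precat \<Rightarrow> ('m \<times> 'm) set \<Rightarrow> 'o \<Rightarrow> 'o \<Rightarrow> ('m \<times> 'm) set monoid" where
  "Ext C E Z X = \<lparr>carrier = ext_conflations C E Z X // ext_equiv C E Z X,
                  mult = baer_sum C E Z X, one = ext_zero C E Z X\<rparr>"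

definition ext_vanishes :: "('o, 'm) precat \<Rightarrow> ('m \<times> 'm) set \<Rightarrow> 'o \<Rightarrow> 'o \<Rightarrow> bool" where
  "ext_vanishes C E Z X \<longleftrightarrow> carrier (Ext C E Z X) = {\<one>\<^bsub>Ext C E Z X\<^esub>}"

definition ext_map_vanishes :: "('o, 'm) precat \<Rightarrow> ('m \<times> 'm) set \<Rightarrow> 'm \<Rightarrow> 'm \<Rightarrow> bool" where
  "ext_map_vanishes C E i j \<longleftrightarrow>
     (\<forall>\<xi> \<in> carrier (Ext C E (Cod C i) (Dom C j)).
        ext_map C E i j \<xi> = \<one>\<^bsub>Ext C E (Dom C i) (Cod C j)\<^esub>)"


section \<open>Cotorsion pairs\<close>

definition left_perp :: "('o, 'm) precat \<Rightarrow> ('m \<times> 'm) set \<Rightarrow> 'o set \<Rightarrow> 'o set" where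
  "left_perp C E \<C> = {F \<in> Obj C. \<forall>X\<in>\<C>. ext_vanishes C E F X}"

definition right_perp :: "('o, 'm) precat \<Rightarrow> ('m \<times> 'm) set \<Rightarrow> 'o set \<Rightarrow> 'o set" where
  "right_perp C E \<F> = {X \<in> Obj C. \<forall>F\<in>\<F>. ext_vanishes C E F X}"

definition cotorsion_pair ::
    "('o, 'm) precat \<Rightarrow> ('m \<times> 'm) set \<Rightarrow> 'o set \<Rightarrow> 'o set \<Rightarrow> bool" where
  "cotorsion_pair C E \<F> \<C> \<longleftrightarrow> \<F> = left_perp C E \<C> \<and> \<C> = right_perp C E \<F>"

definition special_precovering_pair ::
    "('o, 'm) precat \<Rightarrow> ('m \<times> 'm) set \<Rightarrow> 'o set \<Rightarrow> 'o set \<Rightarrow> bool" where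
  "special_precovering_pair C E \<F> \<C> \<longleftrightarrow>
     (\<forall>A\<in>Obj C. \<exists>(f, g)\<in>E. Cod C g = A \<and> Dom C g \<in> \<F> \<and> Dom C f \<in> \<C>)"

definition special_preenveloping_pair ::
    "('o, 'm) precat \<Rightarrow> ('m \<times> 'm) set \<Rightarrow> 'o set \<Rightarrow> 'o set \<Rightarrow> bool" where
  "special_preenveloping_pair C E \<F> \<C> \<longleftrightarrow>
     (\<forall>A\<in>Obj C. \<exists>(f, g)\<in>E. Dom C f = A \<and> Cod C f \<in> \<C> \<and> Cod C g \<in> \<F>)"

definition complete_cotorsion_pair ::
    "('o, 'm) precat \<Rightarrow> ('m \<times> 'm) set \<Rightarrow> 'o set \<Rightarrow> 'o set \<Rightarrow> bool" where
  "complete_cotorsion_pair C E \<F> \<C> \<longleftrightarrow> cotorsion_pair C E \<F> \<C> \<and>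
     special_precovering_pair C E \<F> \<C> \<and> special_preenveloping_pair C E \<F> \<C>"


section \<open>Ideals and ideal cotorsion pairs\<close>

definition mor_ideal :: "('o, 'm) precat \<Rightarrow> 'm set \<Rightarrow> bool" where
  "mor_ideal C I \<longleftrightarrow> I \<subseteq> Arr C \<and>
     (\<forall>X\<in>Obj C. \<forall>Y\<in>Obj C. Zero C X Y \<in> I) \<and>
     (\<forall>f\<in>I. \<forall>g\<in>I. Dom C f = Dom C g \<and> Cod C f = Cod C g \<longrightarrow> f \<boxplus>\<^bsub>C\<^esub> g \<in> I) \<and>
     (\<forall>f\<in>I. \<forall>g\<in>Arr C. Dom C g = Cod C f \<longrightarrow> g \<cdot>\<^bsub>C\<^esub> f \<in> I) \<and>
     (\<forall>f\<in>I. \<forall>g\<in>Arr C. Cod C g = Dom C f \<longrightarrow> f \<cdot>\<^bsub>C\<^esub> g \<in> I)"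

definition ideal_of :: "('o, 'm) precat \<Rightarrow> 'o set \<Rightarrow> 'm set" where
  "ideal_of C \<X> = {g \<cdot>\<^bsub>C\<^esub> f | f g. f \<in> Arr C \<and> g \<in> Arr C \<and> Cod C f = Dom C g \<and> Cod C f \<in> \<X>}"

definition ideal_objects :: "('o, 'm) precat \<Rightarrow> 'm set \<Rightarrow> 'o set" where
  "ideal_objects C I = {X \<in> Obj C. Id C X \<in> I}"

definition object_ideal :: "('o, 'm) precat \<Rightarrow> 'm set \<Rightarrow> bool" where
  "object_ideal C I \<longleftrightarrow> mor_ideal C I \<and> I = ideal_of C (ideal_objects C I)"

definition ideal_left_perp :: "('o, 'm) precat \<Rightarrow> ('m \<times> 'm) set \<Rightarrow> 'm set \<Rightarrow> 'm set" where
  "ideal_left_perp C E J = {i \<in> Arr C. \<forall>j\<in>J. ext_map_vanishes C E i j}"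

definition ideal_right_perp :: "('o, 'm) precat \<Rightarrow> ('m \<times> 'm) set \<Rightarrow> 'm set \<Rightarrow> 'm set" where
  "ideal_right_perp C E I = {j \<in> Arr C. \<forall>i\<in>I. ext_map_vanishes C E i j}"

definition ideal_cotorsion_pair ::
    "('o, 'm) precat \<Rightarrow> ('m \<times> 'm) set \<Rightarrow> 'm set \<Rightarrow> 'm set \<Rightarrow> bool" where
  "ideal_cotorsion_pair C E I J \<longleftrightarrow> mor_ideal C I \<and> mor_ideal C J \<and>
     I = ideal_left_perp C E J \<and> J = ideal_right_perp C E I"

definition special_precover ::
    "('o, 'm) precat \<Rightarrow> ('m \<times> 'm) set \<Rightarrow> 'm set \<Rightarrow> 'o \<Rightarrow> 'm \<Rightarrow> bool" where
  "special_precover C E I A i \<longleftrightarrow> i \<in> I \<and> Cod C i = A \<and>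
     (\<exists>k e. \<exists>j \<in> ideal_right_perp C E I. conflation_pushout C E j e (k, i))"

definition special_preenvelope ::
    "('o, 'm) precat \<Rightarrow> ('m \<times> 'm) set \<Rightarrow> 'm set \<Rightarrow> 'o \<Rightarrow> 'm \<Rightarrow> bool" where
  "special_preenvelope C E J A j \<longleftrightarrow> j \<in> J \<and> Dom C j = A \<and>
     (\<exists>c e. \<exists>i \<in> ideal_left_perp C E J. conflation_pullback C E i e (j, c))"

definition special_precovering_ideal ::
    "('o, 'm) precat \<Rightarrow> ('m \<times> 'm) set \<Rightarrow> 'm set \<Rightarrow> bool" where
  "special_precovering_ideal C E I \<longleftrightarrow> (\<forall>A\<in>Obj C. \<exists>i. special_precover C E I A i)"

definition special_preenveloping_ideal ::
    "('o, 'm) precat \<Rightarrow> ('m \<times> 'm) set \<Rightarrow> 'm set \<Rightarrow> bool" where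
  "special_preenveloping_ideal C E J \<longleftrightarrow> (\<forall>A\<in>Obj C. \<exists>j. special_preenvelope C E J A j)"

definition complete_ideal_cotorsion_pair ::
    "('o, 'm) precat \<Rightarrow> ('m \<times> 'm) set \<Rightarrow> 'm set \<Rightarrow> 'm set \<Rightarrow> bool" where
  "complete_ideal_cotorsion_pair C E I J \<longleftrightarrow> ideal_cotorsion_pair C E I J \<and>
     special_precovering_ideal C E I \<and> special_preenveloping_ideal C E J"

end

theory Submission
  imports Defs
begin

text \<open>For \<open>M\<close> in \<open>A\<close> choose an epimorphism \<open>P \<rightarrow> M\<close> with \<open>P\<close> projective and an object \<open>T\<close> with
  \<open>lam T \<ge> lam M\<close>, for instance a power of an object with positive \<open>lam\<close>. The kernel of the
  composite \<open>P \<oplus> T \<rightarrow> P \<rightarrow> M\<close> has \<open>lam\<close> equal to \<open>lam T - lam M \<ge> 0\<close>, so this composite is a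
  deflation of \<open>A\<close> that lies in the ideal of the projectives. Hence the ideal is special
  precovering although the objects \<open>P \<oplus> T\<close> need not be projective. The projectives of \<open>A\<close> are those
  of \<open>B\<close>, on which \<open>lam\<close> vanishes, so a special precover of \<open>S\<close> with \<open>lam S > 0\<close> by projective
  objects would have a kernel with negative \<open>lam\<close>. For the same reason the projection
  \<open>S \<oplus> K \<rightarrow> S\<close>, with \<open>K\<close> the kernel of an epimorphism from a projective onto \<open>S\<close>, has no kernel
  in \<open>A\<close>.\<close>

text \<open>An epimorphism of B between objects of A is a deflation of A exactly when
  \<open>lam\<close> does not increase from its domain to its codomain. A summand T on which the
  arrow vanishes therefore turns an epimorphism from P into a deflation that still factors through
  P. The ideal of the projectives tolerates such a summand, the class of projective objects does
  not; the example lives in this gap. Every Ext map vanishes against the ideal of the projectives,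
  so its right orthogonal consists of all arrows, and identities serve as preenvelopes. Conversely,
  an arrow orthogonal to all identities lifts along every deflation onto its codomain, in particular
  along one that lies in the ideal, and so lies in the ideal itself. The obstacle is the comparison
  of A with B: projectivity in A is tested on fewer arrows, kernels in A on fewer objects. A
  splitting of P (+) T -> X settles the first point; the second is settled because all projectives
  of B lie in A.\<close>

section \<open>Calculus in preadditive categories\<close>

lemma Hom_iff [simp]: "f \<in> Hom C X Y \<longleftrightarrow> f \<in> Arr C \<and> Dom C f = X \<and> Cod C f = Y"
  by (auto simp: Hom_def)

context preadditive_category
begin

lemma Dom_obj [simp]: "f \<in> Arr C \<Longrightarrow> Dom C f \<in> Obj C"
  and Cod_obj [simp]: "f \<in> Arr C \<Longrightarrow> Cod C f \<in> Obj C"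
  by (fact dom_obj, fact cod_obj)

lemma Id_simps [simp]:
  assumes "X \<in> Obj C"
  shows "Id C X \<in> Arr C" "Dom C (Id C X) = X" "Cod C (Id C X) = X"
  using id_hom[OF assms] by auto

lemma comp_simps [simp]:
  assumes "f \<in> Arr C" "g \<in> Arr C" "Cod C f = Dom C g"
  shows "g \<cdot> f \<in> Arr C" "Dom C (g \<cdot> f) = Dom C f" "Cod C (g \<cdot> f) = Cod C g"
  using comp_hom[of f "Dom C f" "Cod C f" g "Cod C g"] assms by auto

lemma comp_Id [simp]:
  "\<lbrakk>f \<in> Arr C; X = Dom C f\<rbrakk> \<Longrightarrow> f \<cdot> Id C X = f"
  "\<lbrakk>f \<in> Arr C; Y = Cod C f\<rbrakk> \<Longrightarrow> Id C Y \<cdot> f = f"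
  using comp_id_right[of f X "Cod C f"] comp_id_left[of f "Dom C f" Y] by auto

lemma assoc [simp]:
  "\<lbrakk>f \<in> Arr C; g \<in> Arr C; h \<in> Arr C; Cod C f = Dom C g; Cod C g = Dom C h\<rbrakk>
    \<Longrightarrow> (h \<cdot> g) \<cdot> f = h \<cdot> (g \<cdot> f)"
  using comp_assoc[of f "Dom C f" "Cod C f" g "Cod C g" h "Cod C h"] by auto

text \<open>Simplification nests composites to the right, which hides the redex
  \<open>g \<cdot> f\<close> inside \<open>g \<cdot> (f \<cdot> u)\<close>. This form makes a known
  equation usable in front of a further arrow.\<close>

lemma comp_reduce:
  "\<lbrakk>g \<cdot> f = h; f \<in> Arr C; g \<in> Arr C; u \<in> Arr C; Cod C f = Dom C g; Cod C u = Dom C f\<rbrakk>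
    \<Longrightarrow> g \<cdot> (f \<cdot> u) = h \<cdot> u"
  using assoc[of u f g] by simp

section \<open>Arithmetic in the Hom groups\<close>

lemma hom_group_simps [simp]:
  "carrier (hom_group C X Y) = Hom C X Y" "mult (hom_group C X Y) = Add C"
  "one (hom_group C X Y) = Zero C X Y"
  by (auto simp: hom_group_def)

lemma Zero_simps [simp]:
  assumes "X \<in> Obj C" "Y \<in> Obj C"
  shows "Zero C X Y \<in> Arr C" "Dom C (Zero C X Y) = X" "Cod C (Zero C X Y) = Y"
proof -
  interpret G: comm_group "hom_group C X Y" using hom_comm_group assms by blast
  show "Zero C X Y \<in> Arr C" "Dom C (Zero C X Y) = X" "Cod C (Zero C X Y) = Y"
    using G.one_closed by auto
qed

lemma add_simps [simp]:
  assumes "f \<in> Arr C" "g \<in> Arr C" "Dom C f = Dom C g" "Cod C f = Cod C g"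
  shows "f \<boxplus> g \<in> Arr C" "Dom C (f \<boxplus> g) = Dom C g" "Cod C (f \<boxplus> g) = Cod C g"
proof -
  interpret G: comm_group "hom_group C (Dom C f) (Cod C f)" using hom_comm_group assms by simp
  show "f \<boxplus> g \<in> Arr C" "Dom C (f \<boxplus> g) = Dom C g" "Cod C (f \<boxplus> g) = Cod C g"
    using G.m_closed[of f g] assms by auto
qed

lemma
  shows add_commute: "\<lbrakk>f \<in> Arr C; g \<in> Arr C; Dom C f = Dom C g; Cod C f = Cod C g\<rbrakk>
      \<Longrightarrow> f \<boxplus> g = g \<boxplus> f"
    and add_assoc: "\<lbrakk>f \<in> Arr C; g \<in> Arr C; h \<in> Arr C; Dom C f = Dom C g; Cod C f = Cod C g;
      Dom C g = Dom C h; Cod C g = Cod C h\<rbrakk> \<Longrightarrow> (f \<boxplus> g) \<boxplus> h = f \<boxplus> (g \<boxplus> h)"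
proof -
  assume *: "f \<in> Arr C" "g \<in> Arr C" "Dom C f = Dom C g" "Cod C f = Cod C g"
  interpret G: comm_group "hom_group C (Dom C f) (Cod C f)" using hom_comm_group * by simp
  show "f \<boxplus> g = g \<boxplus> f" using G.m_comm[of f g] * by auto
next
  assume *: "f \<in> Arr C" "g \<in> Arr C" "h \<in> Arr C" "Dom C f = Dom C g" "Cod C f = Cod C g"
      "Dom C g = Dom C h" "Cod C g = Cod C h"
  interpret G: comm_group "hom_group C (Dom C f) (Cod C f)" using hom_comm_group * by simp
  show "(f \<boxplus> g) \<boxplus> h = f \<boxplus> (g \<boxplus> h)" using G.m_assoc[of f g h] * by auto
qed

lemma add_Zero [simp]:
  "\<lbrakk>f \<in> Arr C; X = Dom C f; Y = Cod C f\<rbrakk> \<Longrightarrow> f \<boxplus> Zero C X Y = f"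
  "\<lbrakk>f \<in> Arr C; X = Dom C f; Y = Cod C f\<rbrakk> \<Longrightarrow> Zero C X Y \<boxplus> f = f"
proof -
  assume *: "f \<in> Arr C" "X = Dom C f" "Y = Cod C f"
  interpret G: comm_group "hom_group C X Y" using hom_comm_group * by simp
  show "f \<boxplus> Zero C X Y = f" "Zero C X Y \<boxplus> f = f" using G.r_one[of f] G.l_one[of f] * by auto
qed

lemma add_left_cancel:
  assumes "f \<in> Arr C" "g \<in> Arr C" "h \<in> Arr C" "Dom C f = Dom C g" "Cod C f = Cod C g"
    "Dom C f = Dom C h" "Cod C f = Cod C h" "h \<boxplus> f = h \<boxplus> g"
  shows "f = g"
proof -
  interpret G: comm_group "hom_group C (Dom C f) (Cod C f)" using hom_comm_group assms by simp
  show ?thesis using G.Units_l_cancel[of h f g] G.Units_eq assms by auto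
qed

definition neg :: "'m \<Rightarrow> 'm" where
  "neg f = inv\<^bsub>hom_group C (Dom C f) (Cod C f)\<^esub> f"

lemma neg_simps [simp]:
  assumes "f \<in> Arr C"
  shows "neg f \<in> Arr C" "Dom C (neg f) = Dom C f" "Cod C (neg f) = Cod C f"
    "f \<boxplus> neg f = Zero C (Dom C f) (Cod C f)" "neg f \<boxplus> f = Zero C (Dom C f) (Cod C f)"
proof -
  interpret G: comm_group "hom_group C (Dom C f) (Cod C f)" using hom_comm_group assms by simp
  show "neg f \<in> Arr C" "Dom C (neg f) = Dom C f" "Cod C (neg f) = Cod C f"
    "f \<boxplus> neg f = Zero C (Dom C f) (Cod C f)" "neg f \<boxplus> f = Zero C (Dom C f) (Cod C f)"
    unfolding neg_def
    using G.inv_closed[of f] G.r_inv[of f] G.l_inv[of f] assms by auto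
qed

lemma neg_Zero [simp]:
  assumes "X \<in> Obj C" "Y \<in> Obj C"
  shows "neg (Zero C X Y) = Zero C X Y"
proof -
  have "neg (Zero C X Y) = Zero C X Y \<boxplus> neg (Zero C X Y)" using assms by (simp del: neg_simps(4))
  then show ?thesis using assms by simp
qed

lemma eq_if_diff_Zero:
  assumes "f \<in> Arr C" "g \<in> Arr C" "Dom C f = Dom C g" "Cod C f = Cod C g"
    "f \<boxplus> neg g = Zero C (Dom C f) (Cod C f)"
  shows "f = g"
proof (rule add_left_cancel[where h = "neg g"])
  show "neg g \<boxplus> f = neg g \<boxplus> g" using assms add_commute[of "neg g" f] by simp
qed (use assms in auto)

lemma distrib [simp]:
  "\<lbrakk>f \<in> Arr C; f' \<in> Arr C; g \<in> Arr C; Dom C f = Dom C f'; Cod C f = Cod C f'; Cod C f' = Dom C g\<rbrakk>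
    \<Longrightarrow> g \<cdot> (f \<boxplus> f') = (g \<cdot> f) \<boxplus> (g \<cdot> f')"
  "\<lbrakk>f \<in> Arr C; g \<in> Arr C; g' \<in> Arr C; Dom C g = Dom C g'; Cod C g = Cod C g'; Cod C f = Dom C g'\<rbrakk>
    \<Longrightarrow> (g \<boxplus> g') \<cdot> f = (g \<cdot> f) \<boxplus> (g' \<cdot> f)"
  using comp_add_right[of f "Dom C f" "Cod C f" f' g "Cod C g"]
    comp_add_left[of f "Dom C f" "Cod C f" g "Cod C g" g'] by auto

text \<open>By distributivity the composite equals its own double, and cancellation in the Hom group
  makes it zero.\<close>

lemma comp_Zero [simp]:
  assumes "f \<in> Arr C" "X \<in> Obj C"
  shows "Y = Dom C f \<Longrightarrow> f \<cdot> Zero C X Y = Zero C X (Cod C f)"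
    and "Y = Cod C f \<Longrightarrow> Zero C Y X \<cdot> f = Zero C (Dom C f) X"
proof -
  assume "Y = Dom C f"
  with assms have Y: "Y \<in> Obj C" by simp
  let ?z = "f \<cdot> Zero C X Y"
  have "?z = f \<cdot> (Zero C X Y \<boxplus> Zero C X Y)"
    using assms Y by (simp del: distrib)
  also have "\<dots> = ?z \<boxplus> ?z"
    using assms Y \<open>Y = Dom C f\<close> by (intro distrib) auto
  finally have "?z \<boxplus> ?z = ?z \<boxplus> Zero C X (Cod C f)"
    using add_Zero(1)[of ?z X "Cod C f"] assms Y \<open>Y = Dom C f\<close> by simp
  then show "?z = Zero C X (Cod C f)"
    using add_left_cancel[of ?z "Zero C X (Cod C f)" ?z] assms \<open>Y = Dom C f\<close> by simp
next
  assume "Y = Cod C f"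
  with assms have Y: "Y \<in> Obj C" by simp
  let ?z = "Zero C Y X \<cdot> f"
  have "?z = (Zero C Y X \<boxplus> Zero C Y X) \<cdot> f"
    using assms Y by (simp del: distrib)
  also have "\<dots> = ?z \<boxplus> ?z"
    using assms Y \<open>Y = Cod C f\<close> by (intro distrib) auto
  finally have "?z \<boxplus> ?z = ?z \<boxplus> Zero C (Dom C f) X"
    using add_Zero(1)[of ?z "Dom C f" X] assms Y \<open>Y = Cod C f\<close> by simp
  then show "?z = Zero C (Dom C f) X"
    using add_left_cancel[of ?z "Zero C (Dom C f) X" ?z] assms \<open>Y = Cod C f\<close> by simp
qed

lemma comp_neg [simp]:
  assumes "f \<in> Arr C" "g \<in> Arr C" "Cod C f = Dom C g"
  shows "g \<cdot> neg f = neg (g \<cdot> f)" "neg g \<cdot> f = neg (g \<cdot> f)"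
proof -
  have "g \<cdot> f \<boxplus> g \<cdot> neg f = Zero C (Dom C f) (Cod C g)"
    using distrib(1)[of f "neg f" g] assms by simp
  then show "g \<cdot> neg f = neg (g \<cdot> f)"
    using assms by - (rule add_left_cancel[where h = "g \<cdot> f"], auto)
  have "g \<cdot> f \<boxplus> neg g \<cdot> f = Zero C (Dom C f) (Cod C g)"
    using distrib(2)[of f g "neg g"] assms by simp
  then show "neg g \<cdot> f = neg (g \<cdot> f)"
    using assms by - (rule add_left_cancel[where h = "g \<cdot> f"], auto)
qed

section \<open>Isomorphisms, monomorphisms and kernels\<close>

lemma isoI:
  "\<lbrakk>f \<in> Arr C; g \<in> Arr C; Dom C g = Cod C f; Cod C g = Dom C f;
    g \<cdot> f = Id C (Dom C f); f \<cdot> g = Id C (Cod C f)\<rbrakk> \<Longrightarrow> is_iso C f"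
  by (auto simp: is_iso_def)

lemma isoE:
  assumes "is_iso C f"
  obtains g where "f \<in> Arr C" "g \<in> Arr C" "Dom C g = Cod C f" "Cod C g = Dom C f"
    "g \<cdot> f = Id C (Dom C f)" "f \<cdot> g = Id C (Cod C f)"
  using assms by (auto simp: is_iso_def)

lemma iso_Id [simp]: "X \<in> Obj C \<Longrightarrow> is_iso C (Id C X)"
  by (rule isoI[where g = "Id C X"]) auto

text \<open>Taking differences reduces cancellation to arrows annihilated by
  \<open>f\<close>.\<close>

lemma monicI:
  assumes "f \<in> Arr C" "\<And>u. \<lbrakk>u \<in> Arr C; Cod C u = Dom C f; f \<cdot> u = Zero C (Dom C u) (Cod C f)\<rbrakk>
    \<Longrightarrow> u = Zero C (Dom C u) (Dom C f)"
  shows "monic C f"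
  unfolding monic_def
proof (intro conjI ballI impI)
  fix W u v
  assume *: "W \<in> Obj C" "u \<in> Hom C W (Dom C f)" "v \<in> Hom C W (Dom C f)" "f \<cdot> u = f \<cdot> v"
  have "u \<boxplus> neg v = Zero C (Dom C (u \<boxplus> neg v)) (Dom C f)"
    by (rule assms(2)) (use * assms(1) in auto)
  then show "u = v" using * by - (rule eq_if_diff_Zero, auto)
qed (fact assms)

lemma monic_cancel:
  "\<lbrakk>monic C f; f \<cdot> u = f \<cdot> v; u \<in> Arr C; v \<in> Arr C; Dom C u = Dom C v; Cod C u = Dom C f;
    Cod C v = Dom C f\<rbrakk> \<Longrightarrow> u = v"
  unfolding monic_def by (metis Dom_obj Hom_iff)

lemma monic_cancel_Zero:
  assumes "monic C f" "f \<cdot> u = Zero C (Dom C u) (Cod C f)" "u \<in> Arr C" "Cod C u = Dom C f"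
  shows "u = Zero C (Dom C u) (Dom C f)"
proof (rule monic_cancel[OF assms(1)])
  have "f \<in> Arr C" using assms by (simp add: monic_def)
  then show "f \<cdot> u = f \<cdot> Zero C (Dom C u) (Dom C f)" 
   "u \<in> Arr C" "Zero C (Dom C u) (Dom C f) \<in> Arr C"
   "Dom C u = Dom C (Zero C (Dom C u) (Dom C f))" "Cod C u = Dom C f"
    "Cod C (Zero C (Dom C u) (Dom C f)) = Dom C f" using assms by auto
qed

lemma kernelD:
  assumes "is_kernel C k f"
  shows "k \<in> Arr C" "f \<in> Arr C" "Cod C k = Dom C f" "f \<cdot> k = Zero C (Dom C k) (Cod C f)"
  using assms by (auto simp: is_kernel_def)

lemma kernel_monic:
  assumes "is_kernel C k f"
  shows "monic C k"
proof (rule monicI)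
  note k = kernelD[OF assms]
  show "k \<in> Arr C" by fact
  fix u assume u: "u \<in> Arr C" "Cod C u = Dom C k" "k \<cdot> u = Zero C (Dom C u) (Cod C k)"
  have "\<exists>!u'. u' \<in> Hom C (Dom C u) (Dom C k) \<and> k \<cdot> u' = Zero C (Dom C u) (Dom C f)"
    using assms u(1) k unfolding is_kernel_def by simp
  then show "u = Zero C (Dom C u) (Dom C k)"
    using k u by (metis comp_Zero(1) Zero_simps Hom_iff Dom_obj)
qed

lemma kernelE:
  assumes "is_kernel C k f" "h \<in> Arr C" "Cod C h = Dom C f" "f \<cdot> h = Zero C (Dom C h) (Cod C f)"
  obtains u where "u \<in> Arr C" "Dom C u = Dom C h" "Cod C u = Dom C k" "k \<cdot> u = h"
  using assms unfolding is_kernel_def by (metis Dom_obj Hom_iff)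

text \<open>Uniqueness of factorizations is monicity of \<open>k\<close>, so only existence is left
  to check in applications.\<close>

lemma kernelI:
  assumes "monic C k" "f \<in> Arr C" "Cod C k = Dom C f" "f \<cdot> k = Zero C (Dom C k) (Cod C f)"
    "\<And>h. \<lbrakk>h \<in> Arr C; Cod C h = Dom C f; f \<cdot> h = Zero C (Dom C h) (Cod C f)\<rbrakk>
      \<Longrightarrow> \<exists>u. u \<in> Arr C \<and> Dom C u = Dom C h \<and> Cod C u = Dom C k \<and> k \<cdot> u = h"
  shows "is_kernel C k f"
  unfolding is_kernel_def
proof (intro conjI ballI impI)
  show k: "k \<in> Arr C" using assms by (simp add: monic_def)
  fix W h assume *: "W \<in> Obj C" "h \<in> Hom C W (Dom C f)" "f \<cdot> h = Zero C W (Cod C f)"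
  then obtain u where u: "u \<in> Arr C \<and> Dom C u = Dom C h \<and> Cod C u = Dom C k \<and> k \<cdot> u = h"
    using assms(5)[of h] by auto
  show "\<exists>!u. u \<in> Hom C W (Dom C k) \<and> k \<cdot> u = h"
  proof (rule ex1I[of _ u])
    show "u \<in> Hom C W (Dom C k) \<and> k \<cdot> u = h" using u * by auto
    fix v assume "v \<in> Hom C W (Dom C k) \<and> k \<cdot> v = h"
    then show "v = u" using u * by - (rule monic_cancel[OF assms(1)], auto)
  qed
qed (use assms in auto)

text \<open>Both \<open>a\<close> and \<open>b\<close> are inverted, whereas \<open>c\<close> is
  only ever cancelled on the left; hence it is merely required to be monic.\<close>

lemma kernel_transport:
  assumes k: "is_kernel C k f" and a: "is_iso C a" "Dom C a = Dom C k"
    and b: "is_iso C b" "Dom C b = Cod C k" and c: "monic C c" "Dom C c = Cod C f"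
    and k': "k' \<in> Arr C" "Dom C k' = Cod C a" "Cod C k' = Cod C b" "b \<cdot> k = k' \<cdot> a"
    and f': "f' \<in> Arr C" "Dom C f' = Cod C b" "Cod C f' = Cod C c" "c \<cdot> f = f' \<cdot> b"
  shows "is_kernel C k' f'"
proof -
  obtain a' where a': "a \<in> Arr C" "a' \<in> Arr C" "Dom C a' = Cod C a" "Cod C a' = Dom C a"
    "a' \<cdot> a = Id C (Dom C a)" "a \<cdot> a' = Id C (Cod C a)" using isoE[OF a(1)] .
  obtain b' where b': "b \<in> Arr C" "b' \<in> Arr C" "Dom C b' = Cod C b" "Cod C b' = Dom C b"
    "b' \<cdot> b = Id C (Dom C b)" "b \<cdot> b' = Id C (Cod C b)" using isoE[OF b(1)] .
  note kd = kernelD[OF k]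
  have ca: "c \<in> Arr C" using c by (simp add: monic_def)
  have k'eq: "k' = b \<cdot> k \<cdot> a'"
    using assoc[of a' a k'] assoc[of a' k b] kd a' b' a b k' by simp
  have f'eq: "c \<cdot> f \<cdot> b' = f'"
    using assoc[of b' b f'] assoc[of b' f c] kd a' b' a b c f' ca by simp
  show ?thesis
  proof (rule kernelI)
    show "monic C k'"
    proof (rule monicI)
      fix u assume u: "u \<in> Arr C" "Cod C u = Dom C k'" "k' \<cdot> u = Zero C (Dom C u) (Cod C k')"
      have "k \<cdot> a' \<cdot> u = b' \<cdot> k' \<cdot> u"
        using u kd a' b' a b k' k'eq comp_reduce[OF b'(5), of "k \<cdot> a' \<cdot> u"] by simp
      also have "\<dots> = Zero C (Dom C (a' \<cdot> u)) (Cod C k)" using u kd a' b' b k' by simp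
      finally have "a' \<cdot> u = Zero C (Dom C (a' \<cdot> u)) (Dom C k)"
        using u kd a' a k' by - (rule monic_cancel_Zero[OF kernel_monic[OF k]], auto)
      then have "a \<cdot> a' \<cdot> u = Zero C (Dom C u) (Cod C a)" using u a' a k' kd by simp
      then show "u = Zero C (Dom C u) (Dom C k')"
        using comp_reduce[OF a'(6), of u] u a' a k' by simp
    qed (fact k')
    \<comment> \<open>The two commuting squares become applicable only after composing with
      \<open>a\<close>, which is removed again by its inverse.\<close>
    have "f' \<cdot> k' \<cdot> a = c \<cdot> f \<cdot> k"
      using k'(4) f'(4) kd a' b' ca a b k' f' c assoc[of k b f'] assoc[of k f c]
      by (metis comp_simps)
    then have "(f' \<cdot> k') \<cdot> a = Zero C (Dom C k) (Cod C c)" using kd a' ca k' f' c by simp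
    then have "((f' \<cdot> k') \<cdot> a) \<cdot> a' = Zero C (Dom C k') (Cod C f')"
      using a' a k' f' kd ca c by (simp del: assoc)
    then show "f' \<cdot> k' = Zero C (Dom C k') (Cod C f')"
      using a' a k' f' by simp
    fix h assume h: "h \<in> Arr C" "Cod C h = Dom C f'" "f' \<cdot> h = Zero C (Dom C h) (Cod C f')"
    have "c \<cdot> f \<cdot> b' \<cdot> h = f' \<cdot> h"
      using f'eq h kd b' ca b f' c by auto
    then have "f \<cdot> b' \<cdot> h = Zero C (Dom C (f \<cdot> b' \<cdot> h)) (Dom C c)"
      using h kd b' ca b f' c by - (rule monic_cancel_Zero[OF c(1)], auto)
    then obtain u where u: "u \<in> Arr C" "Dom C u = Dom C h" "Cod C u = Dom C k" "k \<cdot> u = b' \<cdot> h"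
      using kernelE[OF k, of "b' \<cdot> h"] h kd b' b c f' by auto
    have "k' \<cdot> a \<cdot> u = b \<cdot> k \<cdot> u" using k'(4) assoc[of u a k'] assoc[of u k b] u kd a' a b b' k' by simp
    also have "\<dots> = h" using u comp_reduce[OF b'(6), of h] h b' b f' by simp
    finally show "\<exists>u. u \<in> Arr C \<and> Dom C u = Dom C h \<and> Cod C u = Dom C k' \<and> k' \<cdot> u = h"
      using u a a' k' by (intro exI[of _ "a \<cdot> u"]) auto
  qed (use k' f' in auto)
qed

lemma kernel_unique:
  assumes "is_kernel C k f" "is_kernel C k' f"
  obtains u where "is_iso C u" "Dom C u = Dom C k" "Cod C u = Dom C k'" "k' \<cdot> u = k"
proof -
  note kd = kernelD[OF assms(1)] note kd' = kernelD[OF assms(2)]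
  obtain u where u: "u \<in> Arr C" "Dom C u = Dom C k" "Cod C u = Dom C k'" "k' \<cdot> u = k"
    using kernelE[OF assms(2), of k] kd by auto
  obtain v where v: "v \<in> Arr C" "Dom C v = Dom C k'" "Cod C v = Dom C k" "k \<cdot> v = k'"
    using kernelE[OF assms(1), of k'] kd' by auto
  have "v \<cdot> u = Id C (Dom C k)"
    by (rule monic_cancel[OF kernel_monic[OF assms(1)]])
      (use comp_reduce[OF v(4), of u] u v kd kd' in auto)
  moreover have "u \<cdot> v = Id C (Dom C k')"
    by (rule monic_cancel[OF kernel_monic[OF assms(2)]])
      (use comp_reduce[OF u(4), of v] u v kd kd' in auto)
  ultimately have "is_iso C u" using u v by (intro isoI[of u v]) auto
  then show thesis using u that by blast
qed

section \<open>Pullbacks and their kernels\<close>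

lemma pullbackD:
  assumes "is_pullback C g a b g'"
  shows "g \<in> Arr C" "a \<in> Arr C" "b \<in> Arr C" "g' \<in> Arr C" "Cod C g = Cod C a"
    "Cod C b = Dom C g" "Cod C g' = Dom C a" "Dom C b = Dom C g'" "g \<cdot> b = a \<cdot> g'"
  using assms by (auto simp: is_pullback_def)

lemma pullbackE:
  assumes "is_pullback C g a b g'" "u \<in> Arr C" "v \<in> Arr C" "Dom C u = Dom C v"
    "Cod C u = Dom C g" "Cod C v = Dom C a" "g \<cdot> u = a \<cdot> v"
  obtains w where "w \<in> Arr C" "Dom C w = Dom C u" "Cod C w = Dom C b" "b \<cdot> w = u" "g' \<cdot> w = v"
proof -
  have "Dom C u \<in> Obj C" "u \<in> Hom C (Dom C u) (Dom C g)" "v \<in> Hom C (Dom C u) (Dom C a)"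
    using assms by auto
  then have "\<exists>!w. w \<in> Hom C (Dom C u) (Dom C b) \<and> b \<cdot> w = u \<and> g' \<cdot> w = v"
    using assms(1,7) unfolding is_pullback_def by blast
  then show thesis using that by auto
qed

lemma pullback_eq:
  assumes "is_pullback C g a b g'" "u \<in> Arr C" "v \<in> Arr C" "Dom C u = Dom C v"
    "Cod C u = Dom C b" "Cod C v = Dom C b" "b \<cdot> u = b \<cdot> v" "g' \<cdot> u = g' \<cdot> v"
  shows "u = v"
proof -
  note p = pullbackD[OF assms(1)]
  have "Dom C u \<in> Obj C" "b \<cdot> u \<in> Hom C (Dom C u) (Dom C g)"
    "g' \<cdot> u \<in> Hom C (Dom C u) (Dom C a)" "g \<cdot> b \<cdot> u = a \<cdot> g' \<cdot> u"
    using p assms comp_reduce[OF p(9), of u] by auto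
  then have "\<exists>!w. w \<in> Hom C (Dom C u) (Dom C b) \<and> b \<cdot> w = b \<cdot> u \<and> g' \<cdot> w = g' \<cdot> u"
    using assms(1) unfolding is_pullback_def by blast
  then show ?thesis using assms by auto
qed

lemma pullbackI:
  assumes "g \<in> Arr C" "a \<in> Arr C" "b \<in> Arr C" "g' \<in> Arr C" "Cod C g = Cod C a"
    "Cod C b = Dom C g" "Cod C g' = Dom C a" "Dom C b = Dom C g'" "g \<cdot> b = a \<cdot> g'"
    "\<And>u v. \<lbrakk>u \<in> Arr C; v \<in> Arr C; Dom C u = Dom C v; Cod C u = Dom C g; Cod C v = Dom C a;
       g \<cdot> u = a \<cdot> v\<rbrakk> \<Longrightarrow>
       \<exists>w. w \<in> Arr C \<and> Dom C w = Dom C v \<and> Cod C w = Dom C b \<and> b \<cdot> w = u \<and> g' \<cdot> w = v"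
    "\<And>u v. \<lbrakk>u \<in> Arr C; v \<in> Arr C; Dom C u = Dom C v; Cod C u = Dom C b; Cod C v = Dom C b;
       b \<cdot> u = b \<cdot> v; g' \<cdot> u = g' \<cdot> v\<rbrakk> \<Longrightarrow> u = v"
  shows "is_pullback C g a b g'"
  unfolding is_pullback_def
proof (intro conjI ballI impI)
  fix W u v assume *: "W \<in> Obj C" "u \<in> Hom C W (Dom C g)" "v \<in> Hom C W (Dom C a)" "g \<cdot> u = a \<cdot> v"
  then obtain w where "w \<in> Arr C \<and> Dom C w = Dom C v \<and> Cod C w = Dom C b \<and> b \<cdot> w = u \<and> g' \<cdot> w = v"
    using assms(10)[of u v] by auto
  then show "\<exists>!w. w \<in> Hom C W (Dom C b) \<and> b \<cdot> w = u \<and> g' \<cdot> w = v"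
    using * assms(11) by (intro ex1I[of _ w]) auto
qed (use assms in auto)

lemma pullback_Id:
  "g \<in> Arr C \<Longrightarrow> is_pullback C g (Id C (Cod C g)) (Id C (Dom C g)) g"
  by (rule pullbackI) auto

text \<open>The dual is what matters later: it moves a pushout to an isomorphic middle object, so
  that any split conflation can be recognized as a pushout once one is.\<close>

lemma pullback_iso:
  assumes p: "is_pullback C g a b g'" and h: "is_iso C h" "Cod C h = Dom C b"
    and e: "b' = b \<cdot> h" "g'' = g' \<cdot> h"
  shows "is_pullback C g a b' g''"
proof -
  note pd = pullbackD[OF p]
  obtain k where k: "h \<in> Arr C" "k \<in> Arr C" "Dom C k = Cod C h" "Cod C k = Dom C h"
    "k \<cdot> h = Id C (Dom C h)" "h \<cdot> k = Id C (Cod C h)" using isoE[OF h(1)] .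
  show ?thesis
  proof (rule pullbackI)
    show "g \<cdot> b' = a \<cdot> g''" using e pd k h comp_reduce[OF pd(9), of h] by simp
  next
    fix u v assume uv: "u \<in> Arr C" "v \<in> Arr C" "Dom C u = Dom C v" "Cod C u = Dom C g"
      "Cod C v = Dom C a" "g \<cdot> u = a \<cdot> v"
    then obtain w where w: "w \<in> Arr C" "Dom C w = Dom C u" "Cod C w = Dom C b" "b \<cdot> w = u" "g' \<cdot> w = v"
      by (rule pullbackE[OF p])
    show "\<exists>w. w \<in> Arr C \<and> Dom C w = Dom C v \<and> Cod C w = Dom C b' \<and> b' \<cdot> w = u \<and> g'' \<cdot> w = v"
      using w uv pd k h e comp_reduce[OF k(6), of w] by (intro exI[of _ "k \<cdot> w"]) auto
  next
    fix u v assume uv: "u \<in> Arr C" "v \<in> Arr C" "Dom C u = Dom C v" "Cod C u = Dom C b'"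
       "Cod C v = Dom C b'" "b' \<cdot> u = b' \<cdot> v" "g'' \<cdot> u = g'' \<cdot> v"
    then have "h \<cdot> u = h \<cdot> v" using pd k h e by - (rule pullback_eq[OF p], auto)
    then have "k \<cdot> h \<cdot> u = k \<cdot> h \<cdot> v" by simp
    then show "u = v"
      using uv pd k h e comp_reduce[OF k(5), of u] comp_reduce[OF k(5), of v] by simp
  qed (use pd k h e in auto)
qed

text \<open>The pair of \<open>f\<close> and a zero arrow factors through the pullback, and joint
  monicity of \<open>b\<close> and \<open>g'\<close> makes the factor a kernel. The domain stays
  literally \<open>Dom C f\<close>, as \<open>conflation_pullback\<close> demands.\<close>

lemma pullback_kernel:
  assumes k: "is_kernel C f g" and p: "is_pullback C g a b g'"
  obtains f' where "is_kernel C f' g'" "Dom C f' = Dom C f" "b \<cdot> f' = f"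
proof -
  note kd = kernelD[OF k] note pd = pullbackD[OF p]
  obtain f' where f': "f' \<in> Arr C" "Dom C f' = Dom C f" "Cod C f' = Dom C b" "b \<cdot> f' = f"
     "g' \<cdot> f' = Zero C (Dom C f) (Dom C a)"
    using pullbackE[OF p, of f "Zero C (Dom C f) (Dom C a)"] kd pd by auto
  have "is_kernel C f' g'"
  proof (rule kernelI)
    show "monic C f'"
    proof (rule monicI)
      fix u assume u: "u \<in> Arr C" "Cod C u = Dom C f'" "f' \<cdot> u = Zero C (Dom C u) (Cod C f')"
      then have "f \<cdot> u = Zero C (Dom C u) (Cod C f)"
        using comp_reduce[OF f'(4), of u] f' pd kd by simp
      then show "u = Zero C (Dom C u) (Dom C f')"
        using monic_cancel_Zero[OF kernel_monic[OF k], of u] u f' by simp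
    qed (fact f')
    fix h assume h: "h \<in> Arr C" "Cod C h = Dom C g'" "g' \<cdot> h = Zero C (Dom C h) (Cod C g')"
    have "g \<cdot> b \<cdot> h = Zero C (Dom C h) (Cod C g)"
      using comp_reduce[OF pd(9), of h] h pd by simp
    then obtain u where u: "u \<in> Arr C" "Dom C u = Dom C h" "Cod C u = Dom C f" "f \<cdot> u = b \<cdot> h"
      using kernelE[OF k, of "b \<cdot> h"] h pd by auto
    have "f' \<cdot> u = h"
      by (rule pullback_eq[OF p])
        (use u h pd f' kd comp_reduce[OF f'(4), of u] comp_reduce[OF f'(5), of u] in auto)
    then show "\<exists>u. u \<in> Arr C \<and> Dom C u = Dom C h \<and> Cod C u = Dom C f' \<and> f' \<cdot> u = h"
      using u f' by auto
  qed (use f' pd in auto)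
  then show thesis using that f' by blast
qed

section \<open>Biproducts\<close>

lemma biproductD:
  assumes "is_biproduct C X Y S i j p q"
  shows "X \<in> Obj C" "Y \<in> Obj C" "S \<in> Obj C"
    "i \<in> Arr C" "Dom C i = X" "Cod C i = S" "j \<in> Arr C" "Dom C j = Y" "Cod C j = S"
    "p \<in> Arr C" "Dom C p = S" "Cod C p = X" "q \<in> Arr C" "Dom C q = S" "Cod C q = Y"
    "p \<cdot> i = Id C X" "q \<cdot> j = Id C Y" "p \<cdot> j = Zero C Y X" "q \<cdot> i = Zero C X Y"
    "(i \<cdot> p) \<boxplus> (j \<cdot> q) = Id C S"
  using assms Dom_obj Cod_obj unfolding is_biproduct_def Hom_iff by metis+

lemma biproduct_kernel:
  assumes "is_biproduct C X Y S i j p q"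
  shows "is_kernel C i q"
proof -
  note b = biproductD[OF assms]
  show ?thesis
  proof (rule kernelI)
    show "monic C i"
    proof (rule monicI)
      fix u assume "u \<in> Arr C" "Cod C u = Dom C i" "i \<cdot> u = Zero C (Dom C u) (Cod C i)"
      then show "u = Zero C (Dom C u) (Dom C i)"
        using comp_reduce[OF b(16), of u] b by simp
    qed (use b in auto)
    fix h assume h: "h \<in> Arr C" "Cod C h = Dom C q" "q \<cdot> h = Zero C (Dom C h) (Cod C q)"
    \<comment> \<open>The summand through \<open>j\<close> dies because \<open>q\<close> annihilates
      \<open>h\<close>, which leaves \<open>p \<cdot> h\<close> as the factor.\<close>
    have "h = ((i \<cdot> p) \<boxplus> (j \<cdot> q)) \<cdot> h" using h b by (simp del: distrib)
    also have "\<dots> = (i \<cdot> p) \<cdot> h \<boxplus> (j \<cdot> q) \<cdot> h" using h b by (intro distrib) auto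
    also have "\<dots> = i \<cdot> p \<cdot> h" using h b by simp
    finally have "i \<cdot> p \<cdot> h = h" by simp
    then show "\<exists>u. u \<in> Arr C \<and> Dom C u = Dom C h \<and> Cod C u = Dom C i \<and> i \<cdot> u = h"
      using h b by (intro exI[of _ "p \<cdot> h"]) auto
  qed (use b in auto)
qed

end

section \<open>Duality\<close>

text \<open>Objects and arrows are kept and only the structure maps are exchanged. Taking the
  opposite twice is then literally the identity, and dual theorems arise by simplification
  alone.\<close>

definition opcat :: "('o, 'm) precat \<Rightarrow> ('o, 'm) precat" where
  "opcat C = C\<lparr>Dom := Cod C, Cod := Dom C, Comp := (\<lambda>g f. Comp C f g), Zero := (\<lambda>X Y. Zero C Y X)\<rparr>"

lemma opcat_simps [simp]:
  "Obj (opcat C) = Obj C" "Arr (opcat C) = Arr C" "Dom (opcat C) = Cod C" "Cod (opcat C) = Dom C"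
  "Id (opcat C) = Id C" "Comp (opcat C) g f = Comp C f g" "Add (opcat C) = Add C"
  "Zero (opcat C) X Y = Zero C Y X" "opcat (opcat C) = C"
  by (auto simp: opcat_def)

lemma opcat_Hom [simp]: "Hom (opcat C) X Y = Hom C Y X"
  by (auto simp: Hom_def)

lemma opcat_notions [simp]:
  "monic (opcat C) f = epic C f" "epic (opcat C) f = monic C f"
  "is_kernel (opcat C) f g = is_cokernel C f g" "is_cokernel (opcat C) f g = is_kernel C f g"
  "short_exact (opcat C) f g = short_exact C g f"
  "is_iso (opcat C) f = is_iso C f"
  "is_zero_object (opcat C) Z = is_zero_object C Z"
  "is_pullback (opcat C) f a b f' = is_pushout C f a b f'"
  "is_pushout (opcat C) f a b f' = is_pullback C f a b f'"
  "is_biproduct (opcat C) X Y S i j p q = is_biproduct C X Y S p q i j"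
  unfolding monic_def epic_def is_kernel_def is_cokernel_def short_exact_def is_iso_def
    is_zero_object_def is_pullback_def is_pushout_def is_biproduct_def
  by (auto simp del: Hom_iff)

lemma (in preadditive_category) preadditive_opcat: "preadditive_category (opcat C)"
proof (rule preadditive_category.intro)
  fix X Y assume XY: "X \<in> Obj (opcat C)" "Y \<in> Obj (opcat C)"
  have "hom_group (opcat C) X Y = hom_group C Y X"
    by (simp add: hom_group_def del: Hom_iff)
  then show "comm_group (hom_group (opcat C) X Y)" using XY hom_comm_group by simp
qed auto

lemma (in additive_category) additive_opcat: "additive_category (opcat C)"
proof -
  interpret op: preadditive_category "opcat C" by (fact preadditive_opcat)
  show ?thesis
  proof
    show "\<exists>Z. is_zero_object (opcat C) Z" using zero_object by simp
    fix X Y assume "X \<in> Obj (opcat C)" "Y \<in> Obj (opcat C)"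
    then show "\<exists>S i j p q. is_biproduct (opcat C) X Y S i j p q"
      using biproducts by simp metis
  qed
qed

lemma (in abelian_category) abelian_opcat: "abelian_category (opcat C)"
proof -
  interpret op: additive_category "opcat C" by (fact additive_opcat)
  show ?thesis
    by unfold_locales (simp_all add: has_kernels has_cokernels monic_normal epic_normal)
qed

context preadditive_category
begin

section \<open>Epimorphisms, cokernels and short exact sequences\<close>

lemmas epicI = preadditive_category.monicI[OF preadditive_opcat, simplified]
  and epic_cancel = preadditive_category.monic_cancel[OF preadditive_opcat, simplified]
  and epic_cancel_Zero = preadditive_category.monic_cancel_Zero[OF preadditive_opcat, simplified]
  and cokernelD = preadditive_category.kernelD[OF preadditive_opcat, simplified]
  and cokernel_epic = preadditive_category.kernel_monic[OF preadditive_opcat, simplified]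
  and cokernelE = preadditive_category.kernelE[OF preadditive_opcat, simplified]
  and cokernelI = preadditive_category.kernelI[OF preadditive_opcat, simplified]
  and biproduct_cokernel = preadditive_category.biproduct_kernel[OF preadditive_opcat, simplified]

lemma iso_monic:
  assumes "is_iso C f"
  shows "monic C f"
proof -
  obtain g where g: "f \<in> Arr C" "g \<in> Arr C" "Dom C g = Cod C f" "Cod C g = Dom C f"
    "g \<cdot> f = Id C (Dom C f)" "f \<cdot> g = Id C (Cod C f)" using isoE[OF assms] .
  show ?thesis
  proof (rule monicI)
    fix u assume u: "u \<in> Arr C" "Cod C u = Dom C f" "f \<cdot> u = Zero C (Dom C u) (Cod C f)"
    have "u = g \<cdot> f \<cdot> u" using comp_reduce[OF g(5), of u] g u by simp
    also have "\<dots> = Zero C (Dom C u) (Dom C f)" using g u by simp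
    finally show "u = Zero C (Dom C u) (Dom C f)" .
  qed (fact g)
qed

lemmas iso_epic = preadditive_category.iso_monic[OF preadditive_opcat, simplified]

lemma iso_inv:
  assumes "is_iso C f"
  obtains g where "is_iso C g" "Dom C g = Cod C f" "Cod C g = Dom C f"
    "g \<cdot> f = Id C (Dom C f)" "f \<cdot> g = Id C (Cod C f)"
proof -
  obtain g where g: "f \<in> Arr C" "g \<in> Arr C" "Dom C g = Cod C f" "Cod C g = Dom C f"
    "g \<cdot> f = Id C (Dom C f)" "f \<cdot> g = Id C (Cod C f)" using isoE[OF assms] .
  show thesis by (rule that[of g]) (use g in \<open>auto intro: isoI[of g f]\<close>)
qed

lemma retraction_epic:
  assumes "r \<in> Arr C" "s \<in> Arr C" "Dom C s = Cod C r" "Cod C s = Dom C r" "r \<cdot> s = Id C (Cod C r)"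
  shows "epic C r"
proof (rule epicI)
  fix u assume u: "u \<in> Arr C" "Dom C u = Cod C r" "u \<cdot> r = Zero C (Dom C r) (Cod C u)"
  have "u = u \<cdot> r \<cdot> s" using assms u by simp
  also have "\<dots> = (u \<cdot> r) \<cdot> s" using assms u(1,2) by simp
  also have "\<dots> = Zero C (Cod C r) (Cod C u)" unfolding u(3) using assms u(1,2) by simp
  finally show "u = Zero C (Cod C r) (Cod C u)" .
qed (fact assms)

lemma monic_comp:
  assumes "monic C f" "monic C g" "Cod C f = Dom C g"
  shows "monic C (g \<cdot> f)"
proof -
  have fg: "f \<in> Arr C" "g \<in> Arr C" using assms by (auto simp: monic_def)
  show ?thesis
  proof (rule monicI)
    fix u assume u: "u \<in> Arr C" "Cod C u = Dom C (g \<cdot> f)"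
      "(g \<cdot> f) \<cdot> u = Zero C (Dom C u) (Cod C (g \<cdot> f))"
    have "f \<cdot> u = Zero C (Dom C (f \<cdot> u)) (Dom C g)"
      using monic_cancel_Zero[OF assms(2), of "f \<cdot> u"] u fg assms by simp
    then show "u = Zero C (Dom C u) (Dom C (g \<cdot> f))"
      using monic_cancel_Zero[OF assms(1), of u] u fg assms by simp
  qed (use fg assms in auto)
qed

lemmas epic_comp = preadditive_category.monic_comp[OF preadditive_opcat, simplified]

lemma short_exactD:
  assumes "short_exact C f g"
  shows "is_kernel C f g" "is_cokernel C g f" "monic C f" "epic C g" "f \<in> Arr C" "g \<in> Arr C"
    "Cod C f = Dom C g" "g \<cdot> f = Zero C (Dom C f) (Cod C g)"
  using assms kernel_monic cokernel_epic kernelD unfolding short_exact_def by metis+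

lemma zero_arr:
  assumes "is_zero_object C Z" "f \<in> Arr C" "g \<in> Arr C" "Dom C f = Dom C g" "Cod C f = Cod C g"
    "Dom C f = Z \<or> Cod C f = Z"
  shows "f = g"
  using assms Dom_obj Cod_obj unfolding is_zero_object_def Hom_iff by metis

text \<open>The sequence X = X -> 0 serves twice: additivity on it gives \<open>lam\<close> of the
  zero object, and it makes identities inflations.\<close>

lemma short_exact_Id:
  assumes Z: "is_zero_object C Z" and X: "X \<in> Obj C"
  shows "short_exact C (Id C X) (Zero C X Z)"
proof -
  have Z': "Z \<in> Obj C" using Z by (simp add: is_zero_object_def)
  have "is_kernel C (Id C X) (Zero C X Z)"
    by (rule kernelI) (use X Z' iso_monic in auto)
  moreover have "is_cokernel C (Zero C X Z) (Id C X)"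
  proof (rule cokernelI)
    show "epic C (Zero C X Z)"
    proof (rule epicI)
      fix u assume u: "u \<in> Arr C" "Dom C u = Cod C (Zero C X Z)"
      then show "u = Zero C (Cod C (Zero C X Z)) (Cod C u)"
        using X Z' by (intro zero_arr[OF Z]) auto
    qed (use X Z' in auto)
    fix h assume h: "h \<in> Arr C" "Dom C h = Cod C (Id C X)" "h \<cdot> Id C X = Zero C (Dom C (Id C X)) (Cod C h)"
    then show "\<exists>u. u \<in> Arr C \<and> Cod C u = Cod C h \<and> Dom C u = Cod C (Zero C X Z) \<and> u \<cdot> Zero C X Z = h"
      using X Z' by (intro exI[of _ "Zero C Z (Cod C h)"]) auto
  qed (use X Z' in auto)
  ultimately show ?thesis by (simp add: short_exact_def)
qed

lemma biproduct_swap: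
  assumes "is_biproduct C X Y S i j p q"
  shows "is_biproduct C Y X S j i q p"
  using add_commute[of "j \<cdot> q" "i \<cdot> p"] biproductD[OF assms] by (simp add: is_biproduct_def)

lemma biproduct_short_exact: "is_biproduct C X Y S i j p q \<Longrightarrow> short_exact C i q"
  using biproduct_kernel biproduct_cokernel[OF biproduct_swap] by (simp add: short_exact_def)

lemma short_exact_transport:
  assumes "short_exact C f g" "is_iso C a" "is_iso C b" "is_iso C c"
    "Dom C a = Dom C f" "Dom C b = Cod C f" "Dom C c = Cod C g"
    "f' \<in> Arr C" "Dom C f' = Cod C a" "Cod C f' = Cod C b"
    "g' \<in> Arr C" "Dom C g' = Cod C b" "Cod C g' = Cod C c"
    "b \<cdot> f = f' \<cdot> a" "c \<cdot> g = g' \<cdot> b"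
  shows "short_exact C f' g'"
proof -
  note se = short_exactD[OF assms(1)]
  have k: "is_kernel C f' g'"
    by (rule kernel_transport[OF se(1), of a b c])
      (use assms se iso_monic in auto)
  obtain a' where a': "is_iso C a'" "Dom C a' = Cod C a" "Cod C a' = Dom C a"
    "a' \<cdot> a = Id C (Dom C a)" "a \<cdot> a' = Id C (Cod C a)" using iso_inv[OF assms(2)] .
  obtain b' where b': "is_iso C b'" "Dom C b' = Cod C b" "Cod C b' = Dom C b"
    "b' \<cdot> b = Id C (Dom C b)" "b \<cdot> b' = Id C (Cod C b)" using iso_inv[OF assms(3)] .
  obtain c' where c': "is_iso C c'" "Dom C c' = Cod C c" "Cod C c' = Dom C c"
    "c' \<cdot> c = Id C (Dom C c)" "c \<cdot> c' = Id C (Cod C c)" using iso_inv[OF assms(4)] .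
  have arr: "a \<in> Arr C" "b \<in> Arr C" "c \<in> Arr C" "a' \<in> Arr C" "b' \<in> Arr C" "c' \<in> Arr C"
    using assms a' b' c' by (auto simp: is_iso_def)
  note dc = assms(5-13) se(5-7) a'(2,3) b'(2,3) c'(2,3) arr
  \<comment> \<open>The cokernel half is \<open>kernel_transport\<close> in the opposite category.
    There the isomorphisms must point the other way, so both squares are rewritten with the
    inverses.\<close>
  have "f \<cdot> a' = b' \<cdot> (b \<cdot> f) \<cdot> a'"
    using comp_reduce[OF b'(4), of "f \<cdot> a'"] dc by simp
  also have "\<dots> = b' \<cdot> f'"
    unfolding assms(14) using a'(5) dc by simp
  finally have 1: "f \<cdot> a' = b' \<cdot> f'" .
  have "g \<cdot> b' = c' \<cdot> (c \<cdot> g) \<cdot> b'"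
    using comp_reduce[OF c'(4), of "g \<cdot> b'"] dc by simp
  also have "\<dots> = c' \<cdot> g'"
    unfolding assms(15) using b'(5) dc by simp
  finally have 2: "g \<cdot> b' = c' \<cdot> g'" .
  have "is_cokernel C g' f'"
    by (rule preadditive_category.kernel_transport[OF preadditive_opcat, of g f c' b' a', simplified])
      (use assms se iso_epic a' b' c' 1 2 in auto)
  then show ?thesis using k by (simp add: short_exact_def)
qed

end

section \<open>Abelian categories\<close>

context abelian_category
begin

text \<open>By normality \<open>f\<close> is the kernel of some \<open>g\<close>, and
  \<open>g\<close> factors through the cokernel \<open>c\<close>. Whatever \<open>c\<close>
  annihilates is then annihilated by \<open>g\<close> and factors through \<open>f\<close>.\<close>

lemma monic_kernel_of_cokernel:
  assumes "monic C f" "is_cokernel C c f"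
  shows "short_exact C f c"
proof -
  note cd = cokernelD[OF assms(2)]
  obtain g where g: "is_kernel C f g" using monic_normal[OF assms(1)] by blast
  note gd = kernelD[OF g]
  obtain w where w: "w \<in> Arr C" "Dom C w = Cod C c" "Cod C w = Cod C g" "w \<cdot> c = g"
    using cokernelE[OF assms(2), of g] gd by auto
  have "is_kernel C f c"
  proof (rule kernelI[OF assms(1)])
    fix h assume h: "h \<in> Arr C" "Cod C h = Dom C c" "c \<cdot> h = Zero C (Dom C h) (Cod C c)"
    then have "g \<cdot> h = Zero C (Dom C h) (Cod C g)"
      using comp_reduce[OF w(4), of h] w cd gd by simp
    then obtain u where "u \<in> Arr C" "Dom C u = Dom C h" "Cod C u = Dom C f" "f \<cdot> u = h"
      using kernelE[OF g, of h] h cd gd by auto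
    then show "\<exists>u. u \<in> Arr C \<and> Dom C u = Dom C h \<and> Cod C u = Dom C f \<and> f \<cdot> u = h" by blast
  qed (use cd in auto)
  then show ?thesis using assms by (simp add: short_exact_def)
qed

lemmas epic_cokernel_of_kernel =
  abelian_category.monic_kernel_of_cokernel[OF abelian_opcat, simplified]

lemma epic_short_exact: "epic C g \<Longrightarrow> \<exists>f. short_exact C f g"
  using epic_cokernel_of_kernel has_kernels unfolding epic_def by blast

text \<open>The pullback is the kernel \<open>k\<close> of \<open>d\<close>, the arrow with
  components \<open>g\<close> and \<open>-a\<close> on the biproduct of the domains. Since
  \<open>d\<close> restricts to the epic \<open>g\<close>, it is epic and hence the cokernel of
  \<open>k\<close>. An arrow \<open>u\<close> with zero composite \<open>u \<cdot> g'\<close>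
  satisfies \<open>u \<cdot> q = w \<cdot> d\<close> for some \<open>w\<close>; restriction to the
  first summand forces \<open>w\<close>, and then \<open>u\<close>, to vanish.\<close>

lemma epic_pullback:
  assumes "epic C g" "a \<in> Arr C" "Cod C a = Cod C g"
  obtains b g' where "is_pullback C g a b g'" "epic C g'"
proof -
  have g: "g \<in> Arr C" using assms by (simp add: epic_def)
  obtain S i j p q where bi: "is_biproduct C (Dom C g) (Dom C a) S i j p q"
    using biproducts g assms by (meson Dom_obj)
  note bd = biproductD[OF bi]
  define d where "d = g \<cdot> p \<boxplus> neg (a \<cdot> q)"
  have d: "d \<in> Arr C" "Dom C d = S" "Cod C d = Cod C g" using bd g assms by (auto simp: d_def)
  have di: "d \<cdot> i = g" using bd g assms by (simp add: d_def)
  have "epic C d"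
  proof (rule epicI)
    fix u assume u: "u \<in> Arr C" "Dom C u = Cod C d" "u \<cdot> d = Zero C (Dom C d) (Cod C u)"
    have "u \<cdot> d \<cdot> i = (u \<cdot> d) \<cdot> i" using u(1,2) d bd by simp
    also have "\<dots> = Zero C (Dom C g) (Cod C u)" using u d bd by (simp del: assoc)
    finally have "u \<cdot> g = Zero C (Dom C g) (Cod C u)" by (simp add: di)
    then show "u = Zero C (Cod C d) (Cod C u)" using epic_cancel_Zero[OF assms(1)] u d by simp
  qed (fact d)
  obtain k where k: "is_kernel C k d" using has_kernels d by blast
  then have c: "is_cokernel C d k" using epic_cokernel_of_kernel[OF \<open>epic C d\<close>]
    by (simp add: short_exact_def)
  note kd = kernelD[OF k]
  define b g' where "b = p \<cdot> k" and "g' = q \<cdot> k"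
  have bg: "b \<in> Arr C" "Dom C b = Dom C k" "Cod C b = Dom C g"
    "g' \<in> Arr C" "Dom C g' = Dom C k" "Cod C g' = Dom C a"
    using kd bd d by (auto simp: b_def g'_def)
  have dcomp: "d \<cdot> h = (g \<cdot> p \<cdot> h) \<boxplus> neg (a \<cdot> q \<cdot> h)" if "h \<in> Arr C" "Cod C h = S" for h
    using that bd g assms by (simp add: d_def)
  have bi_eq: "h = (i \<cdot> p \<cdot> h) \<boxplus> (j \<cdot> q \<cdot> h)" if "h \<in> Arr C" "Cod C h = S" for h
  proof -
    have "h = ((i \<cdot> p) \<boxplus> (j \<cdot> q)) \<cdot> h" using that bd by (simp del: distrib)
    also have "\<dots> = (i \<cdot> p) \<cdot> h \<boxplus> (j \<cdot> q) \<cdot> h" using that bd by (intro distrib) auto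
    finally show ?thesis using that bd by simp
  qed
  have pb: "is_pullback C g a b g'"
  proof (rule pullbackI)
    show "g \<cdot> b = a \<cdot> g'"
      using dcomp[of k] kd bd d g assms bg
      by - (rule eq_if_diff_Zero, auto simp: b_def g'_def)
  next
    fix u v assume uv: "u \<in> Arr C" "v \<in> Arr C" "Dom C u = Dom C v" "Cod C u = Dom C g"
      "Cod C v = Dom C a" "g \<cdot> u = a \<cdot> v"
    let ?h = "(i \<cdot> u) \<boxplus> (j \<cdot> v)"
    have h: "?h \<in> Arr C" "Dom C ?h = Dom C v" "Cod C ?h = S" using uv bd by auto
    have ph: "p \<cdot> ?h = u"
      using uv bd comp_reduce[OF bd(16), of u] comp_reduce[OF bd(18), of v] by simp
    have qh: "q \<cdot> ?h = v"
      using uv bd comp_reduce[OF bd(17), of v] comp_reduce[OF bd(19), of u] by simp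
    have "d \<cdot> ?h = Zero C (Dom C ?h) (Cod C d)"
      unfolding dcomp[OF h(1,3)] ph qh using uv g assms d h by simp
    then obtain w where w: "w \<in> Arr C" "Dom C w = Dom C ?h" "Cod C w = Dom C k" "k \<cdot> w = ?h"
      using kernelE[OF k, of ?h] h d by metis
    have "b \<cdot> w = p \<cdot> ?h" "g' \<cdot> w = q \<cdot> ?h"
      using w(1-3) kd d bd unfolding w(4)[symmetric] by (auto simp: b_def g'_def)
    then show "\<exists>w. w \<in> Arr C \<and> Dom C w = Dom C v \<and> Cod C w = Dom C b \<and> b \<cdot> w = u \<and> g' \<cdot> w = v"
      using w h ph qh bg by auto
  next
    fix u v assume uv: "u \<in> Arr C" "v \<in> Arr C" "Dom C u = Dom C v" "Cod C u = Dom C b"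
       "Cod C v = Dom C b" "b \<cdot> u = b \<cdot> v" "g' \<cdot> u = g' \<cdot> v"
    have "p \<cdot> k \<cdot> u = p \<cdot> k \<cdot> v" "q \<cdot> k \<cdot> u = q \<cdot> k \<cdot> v"
      using uv kd bd d bg by (simp_all add: b_def g'_def)
    then have "k \<cdot> u = k \<cdot> v"
      using bi_eq[of "k \<cdot> u"] bi_eq[of "k \<cdot> v"] uv kd d bg by simp
    then show "u = v" using uv bg by - (rule monic_cancel[OF kernel_monic[OF k]], auto)
  qed (use bg g assms in auto)
  have "epic C g'"
  proof (rule epicI)
    fix u assume u: "u \<in> Arr C" "Dom C u = Cod C g'" "u \<cdot> g' = Zero C (Dom C g') (Cod C u)"
    then have "(u \<cdot> q) \<cdot> k = Zero C (Dom C k) (Cod C (u \<cdot> q))" using bg bd kd d by (simp add: g'_def)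
    then obtain w where w: "w \<in> Arr C" "Dom C w = Cod C d" "Cod C w = Cod C u" "w \<cdot> d = u \<cdot> q"
      using cokernelE[OF c, of "u \<cdot> q"] u bg bd d kd by auto
    have "w \<cdot> g = w \<cdot> d \<cdot> i" by (simp add: di)
    also have "\<dots> = (w \<cdot> d) \<cdot> i" using w(1-3) d bd by simp
    also have "\<dots> = Zero C (Dom C g) (Cod C u)" using w(4) u bd bg by simp
    finally have "w = Zero C (Cod C g) (Cod C w)"
      using epic_cancel_Zero[OF assms(1), of w] w d by simp
    then have "u \<cdot> q = Zero C S (Cod C u)"
      using w d u by (metis comp_Zero(2) Cod_obj)
    then have "(u \<cdot> q) \<cdot> j = Zero C (Dom C a) (Cod C u)" using bd u by (simp del: assoc)
    then show "u = Zero C (Cod C g') (Cod C u)" using u bd bg by simp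
  qed (fact bg)
  then show thesis using that pb by blast
qed

end

section \<open>Split conflations and the vanishing of Ext\<close>

lemma (in preadditive_category) split_biproduct:
  assumes se: "short_exact C f g" and s: "s \<in> Arr C" "Dom C s = Cod C g" "g \<cdot> s = Id C (Cod C g)"
    "Cod C s = Dom C g"
  obtains r where "is_biproduct C (Dom C f) (Cod C g) (Cod C f) f s r g"
proof -
  note sd = short_exactD[OF se]
  \<comment> \<open>The complementary idempotent of \<open>s \<cdot> g\<close> is annihilated by
    \<open>g\<close>, so it factors through the kernel \<open>f\<close>; the factor is the missing
    projection \<open>r\<close>.\<close>
  let ?d = "Id C (Dom C g) \<boxplus> neg (s \<cdot> g)"
  have "g \<cdot> s \<cdot> g = g" using comp_reduce[OF s(3), of g] s sd by simp
  then have gd: "g \<cdot> ?d = Zero C (Dom C g) (Cod C g)" using s sd by simp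
  obtain r where r: "r \<in> Arr C" "Dom C r = Dom C g" "Cod C r = Dom C f" "f \<cdot> r = ?d"
    using kernelE[OF sd(1), of ?d] gd s sd by auto
  have "f \<cdot> r \<cdot> f = ?d \<cdot> f" using r sd comp_reduce[OF r(4), of f] by simp
  also have "\<dots> = f" using s sd by simp
  finally have rf: "r \<cdot> f = Id C (Dom C f)"
    using r sd(4-) by - (rule monic_cancel[OF sd(3)], auto)
  have "f \<cdot> r \<cdot> s = ?d \<cdot> s" using r s sd comp_reduce[OF r(4), of s] by simp
  also have "\<dots> = Zero C (Cod C g) (Dom C g)" using s sd by simp
  finally have rs: "r \<cdot> s = Zero C (Cod C g) (Dom C f)"
    using r s sd by - (rule monic_cancel[OF sd(3)], auto)
  have "f \<cdot> r \<boxplus> s \<cdot> g = Id C (Dom C g)" using r s sd by (simp add: add_assoc)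
  then show thesis using that[of r] r s sd rf rs by (simp add: is_biproduct_def)
qed

text \<open>Compatibility with one injection and with the opposite projection is the shape of
  \<open>ext_equiv\<close>, so split conflations with the same ends become equivalent.\<close>

lemma (in preadditive_category) biproduct_iso:
  assumes b: "is_biproduct C X Y S i j p q" and b': "is_biproduct C X Y S' i' j' p' q'"
  obtains h where "is_iso C h" "Dom C h = S" "Cod C h = S'" "h \<cdot> i = i'" "q' \<cdot> h = q"
proof -
  note bd = biproductD[OF b] note bd' = biproductD[OF b']
  have comp: "(i2 \<cdot> p1 \<boxplus> j2 \<cdot> q1) \<cdot> (i1 \<cdot> p2 \<boxplus> j1 \<cdot> q2) = Id C S2"
    if "is_biproduct C X Y S1 i1 j1 p1 q1" "is_biproduct C X Y S2 i2 j2 p2 q2"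
    for S1 i1 j1 p1 q1 S2 i2 j2 p2 q2
  proof -
    note d1 = biproductD[OF that(1)] and d2 = biproductD[OF that(2)]
    show ?thesis
      using d1(1-15) d2 comp_reduce[OF d1(16), of p2] comp_reduce[OF d1(17), of q2]
        comp_reduce[OF d1(18), of q2] comp_reduce[OF d1(19), of p2] by simp
  qed
  let ?h = "i' \<cdot> p \<boxplus> j' \<cdot> q" and ?k = "i \<cdot> p' \<boxplus> j \<cdot> q'"
  have "is_iso C ?h"
    by (rule isoI[of ?h ?k]) (use bd(1-15) bd'(1-15) comp[OF b b'] comp[OF b' b] in simp_all)
  moreover have "?h \<cdot> i = i'" using bd bd'(1-15) by simp
  moreover have "q' \<cdot> ?h = q"
    using bd(1-15) bd' comp_reduce[OF bd'(17), of q] comp_reduce[OF bd'(19), of p] by simp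
  ultimately show thesis using that[of ?h] bd(1-15) bd'(1-15) by simp
qed

section \<open>Ideals generated by objects\<close>

lemma ideal_ofI:
  "\<lbrakk>f \<in> Arr C; g \<in> Arr C; Cod C f = Dom C g; Cod C f \<in> \<X>\<rbrakk> \<Longrightarrow> Comp C g f \<in> ideal_of C \<X>"
  unfolding ideal_of_def by blast

lemma ideal_ofE:
  assumes "h \<in> ideal_of C \<X>"
  obtains f g where "h = Comp C g f" "f \<in> Arr C" "g \<in> Arr C" "Cod C f = Dom C g" "Cod C f \<in> \<X>"
  using assms by (auto simp: ideal_of_def)

lemma mor_idealD:
  assumes "mor_ideal C I" "f \<in> I"
  shows "f \<in> Arr C"
    and "\<lbrakk>g \<in> Arr C; Dom C g = Cod C f\<rbrakk> \<Longrightarrow> Comp C g f \<in> I"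
    and "\<lbrakk>g \<in> Arr C; Cod C g = Dom C f\<rbrakk> \<Longrightarrow> Comp C f g \<in> I"
  using assms unfolding mor_ideal_def by blast+

lemma (in preadditive_category) mor_ideal_ideal_of:
  assumes ne: "X0 \<in> \<X>" and sub: "\<X> \<subseteq> Obj C"
    and bi: "\<And>X Y. \<lbrakk>X \<in> \<X>; Y \<in> \<X>\<rbrakk> \<Longrightarrow> \<exists>S i j p q. S \<in> \<X> \<and> is_biproduct C X Y S i j p q"
  shows "mor_ideal C (ideal_of C \<X>)"
  unfolding mor_ideal_def
proof (intro conjI ballI impI)
  show "ideal_of C \<X> \<subseteq> Arr C" by (auto simp: ideal_of_def)
next
  fix X Y assume XY: "X \<in> Obj C" "Y \<in> Obj C"
  have "Zero C X0 Y \<cdot> Zero C X X0 \<in> ideal_of C \<X>"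
    using XY ne sub by (intro ideal_ofI) auto
  moreover have "Zero C X0 Y \<cdot> Zero C X X0 = Zero C X Y" using XY ne sub by auto
  ultimately show "Zero C X Y \<in> ideal_of C \<X>" by simp
next
  fix h h' assume h: "h \<in> ideal_of C \<X>" and h': "h' \<in> ideal_of C \<X>"
    and eq: "Dom C h = Dom C h' \<and> Cod C h = Cod C h'"
  obtain f g where fg: "h = g \<cdot> f" "f \<in> Arr C" "g \<in> Arr C" "Cod C f = Dom C g" "Cod C f \<in> \<X>"
    using ideal_ofE[OF h] .
  obtain f' g' where fg': "h' = g' \<cdot> f'" "f' \<in> Arr C" "g' \<in> Arr C" "Cod C f' = Dom C g'" "Cod C f' \<in> \<X>"
    using ideal_ofE[OF h'] .
  obtain S i j p q where S: "S \<in> \<X>" "is_biproduct C (Cod C f) (Cod C f') S i j p q"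
    using bi fg fg' by meson
  note bd = biproductD[OF S(2)]
  have eq': "Dom C f = Dom C f'" "Cod C g = Cod C g'" using eq fg fg' by auto
  \<comment> \<open>A sum of two factorizations passes through the biproduct of the two middle
    objects; the mixed terms contain \<open>p \<cdot> j\<close> or \<open>q \<cdot> i\<close> and
    vanish.\<close>
  have "(g \<cdot> p \<boxplus> g' \<cdot> q) \<cdot> (i \<cdot> f \<boxplus> j \<cdot> f') = h \<boxplus> h'"
    using fg fg' bd eq' comp_reduce[OF bd(16), of f] comp_reduce[OF bd(17), of f']
      comp_reduce[OF bd(18), of f'] comp_reduce[OF bd(19), of f] by simp
  moreover have "(g \<cdot> p \<boxplus> g' \<cdot> q) \<cdot> (i \<cdot> f \<boxplus> j \<cdot> f') \<in> ideal_of C \<X>"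
    using fg fg' bd(4-15) eq' S(1) by (intro ideal_ofI) simp_all
  ultimately show "h \<boxplus> h' \<in> ideal_of C \<X>" by simp
next
  fix h k assume h: "h \<in> ideal_of C \<X>" and k: "k \<in> Arr C" "Dom C k = Cod C h"
  obtain f g where fg: "h = g \<cdot> f" "f \<in> Arr C" "g \<in> Arr C" "Cod C f = Dom C g" "Cod C f \<in> \<X>"
    using ideal_ofE[OF h] .
  then have "(k \<cdot> g) \<cdot> f \<in> ideal_of C \<X>" using k by (intro ideal_ofI) auto
  then show "k \<cdot> h \<in> ideal_of C \<X>" using fg k by simp
next
  fix h k assume h: "h \<in> ideal_of C \<X>" and k: "k \<in> Arr C" "Cod C k = Dom C h"
  obtain f g where fg: "h = g \<cdot> f" "f \<in> Arr C" "g \<in> Arr C" "Cod C f = Dom C g" "Cod C f \<in> \<X>"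
    using ideal_ofE[OF h] .
  then have "g \<cdot> f \<cdot> k \<in> ideal_of C \<X>" using k by (intro ideal_ofI) auto
  then show "h \<cdot> k \<in> ideal_of C \<X>" using fg k by simp
qed

lemma (in preadditive_category) ideal_of_Obj: "ideal_of C (Obj C) = Arr C"
proof
  show "ideal_of C (Obj C) \<subseteq> Arr C" by (auto simp: ideal_of_def)
  show "Arr C \<subseteq> ideal_of C (Obj C)"
  proof
    fix f assume f: "f \<in> Arr C"
    then have "Id C (Cod C f) \<cdot> f \<in> ideal_of C (Obj C)" by (intro ideal_ofI) auto
    then show "f \<in> ideal_of C (Obj C)" using f by simp
  qed
qed

text \<open>An identity in the ideal absorbs every arrow through its object, so the possibly larger
  class of objects of the ideal generates nothing new.\<close>

lemma (in preadditive_category) object_ideal_ideal_of: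
  assumes "mor_ideal C (ideal_of C \<X>)" "\<X> \<subseteq> Obj C"
  shows "object_ideal C (ideal_of C \<X>)"
  unfolding object_ideal_def
proof (intro conjI equalityI subsetI)
  let ?I = "ideal_of C \<X>"
  fix h assume "h \<in> ?I"
  then obtain f g where fg: "h = g \<cdot> f" "f \<in> Arr C" "g \<in> Arr C" "Cod C f = Dom C g" "Cod C f \<in> \<X>"
    by (rule ideal_ofE)
  then have X: "Cod C f \<in> Obj C" by simp
  then have "Id C (Cod C f) \<cdot> Id C (Cod C f) \<in> ?I" using fg(5) by (intro ideal_ofI) simp_all
  then have "Cod C f \<in> ideal_objects C ?I" using X by (simp add: ideal_objects_def)
  then show "h \<in> ideal_of C (ideal_objects C ?I)" unfolding fg(1) using fg by (intro ideal_ofI)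
next
  let ?I = "ideal_of C \<X>"
  fix h assume "h \<in> ideal_of C (ideal_objects C ?I)"
  then obtain f g where fg: "h = g \<cdot> f" "f \<in> Arr C" "g \<in> Arr C" "Cod C f = Dom C g"
    "Cod C f \<in> ideal_objects C ?I" by (rule ideal_ofE)
  then have "Id C (Cod C f) \<in> ?I" by (simp add: ideal_objects_def)
  then have "Id C (Cod C f) \<cdot> f \<in> ?I" using mor_idealD(3)[OF assms(1), of "Id C (Cod C f)" f] fg by simp
  then have "f \<in> ?I" using fg by simp
  then show "h \<in> ?I" using mor_idealD(2)[OF assms(1), of f g] fg by simp
qed (fact assms)

section \<open>Duality and base change for conflations\<close>

lemma inflation_converse [simp]: "inflation (E\<inverse>) = deflation E" "deflation (E\<inverse>) = inflation E"
  by (auto simp: inflation_def deflation_def)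

lemma conflation_pullback_opcat [simp]:
  "conflation_pullback (opcat C) (E\<inverse>) a (g, f) (g', f') = conflation_pushout C E a (f, g) (f', g')"
  by (simp add: conflation_pullback_def conflation_pushout_def)

lemma Ext_simps [simp]:
  "carrier (Ext C E Z X) = ext_conflations C E Z X // ext_equiv C E Z X"
  "one (Ext C E Z X) = ext_zero C E Z X"
  by (simp_all add: Ext_def)

context exact_category
begin

lemma exact_opcat: "exact_category (opcat C) (E\<inverse>)"
proof -
  interpret op: additive_category "opcat C" by (fact additive_opcat)
  show ?thesis
  proof
    fix f g assume "(f, g) \<in> E\<inverse>"
    then show "short_exact (opcat C) f g" using conflation_short_exact by simp
  next
    fix f g f' X' Y' g' Z' a b c
    assume *: "(f, g) \<in> E\<inverse>" "f' \<in> Hom (opcat C) X' Y'" "g' \<in> Hom (opcat C) Y' Z'"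
      "a \<in> Hom (opcat C) (Dom (opcat C) f) X'" "b \<in> Hom (opcat C) (Cod (opcat C) f) Y'"
      "c \<in> Hom (opcat C) (Cod (opcat C) g) Z'"
      "is_iso (opcat C) a" "is_iso (opcat C) b" "is_iso (opcat C) c"
      "b \<cdot>\<^bsub>opcat C\<^esub> f = f' \<cdot>\<^bsub>opcat C\<^esub> a" "c \<cdot>\<^bsub>opcat C\<^esub> g = g' \<cdot>\<^bsub>opcat C\<^esub> b"
    have gf: "(g, f) \<in> E" using * by simp
    note sd = short_exactD[OF conflation_short_exact[OF gf]]
    from * have iso: "is_iso C a" "is_iso C b" "is_iso C c" by auto
    obtain a' where a': "is_iso C a'" "Dom C a' = Cod C a" "Cod C a' = Dom C a"
      "a' \<cdot> a = Id C (Dom C a)" "a \<cdot> a' = Id C (Cod C a)" using iso_inv[OF iso(1)] .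
    obtain b' where b': "is_iso C b'" "Dom C b' = Cod C b" "Cod C b' = Dom C b"
      "b' \<cdot> b = Id C (Dom C b)" "b \<cdot> b' = Id C (Cod C b)" using iso_inv[OF iso(2)] .
    obtain c' where c': "is_iso C c'" "Dom C c' = Cod C c" "Cod C c' = Dom C c"
      "c' \<cdot> c = Id C (Dom C c)" "c \<cdot> c' = Id C (Cod C c)" using iso_inv[OF iso(3)] .
    have dc: "f' \<in> Arr C" "Dom C f' = Y'" "Cod C f' = X'" "g' \<in> Arr C" "Dom C g' = Z'" "Cod C g' = Y'"
      "a \<in> Arr C" "Dom C a = X'" "Cod C a = Cod C f" "b \<in> Arr C" "Dom C b = Y'" "Cod C b = Dom C f"
      "c \<in> Arr C" "Dom C c = Z'" "Cod C c = Dom C g" "f \<in> Arr C" "g \<in> Arr C" "Cod C g = Dom C f"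
      "a' \<in> Arr C" "b' \<in> Arr C" "c' \<in> Arr C"
      and eq: "f \<cdot> b = a \<cdot> f'" "g \<cdot> c = b \<cdot> g'"
      using * sd a' b' c' by (auto simp: is_iso_def)
    \<comment> \<open>Read in \<open>C\<close>, the given isomorphisms lead into the known
      conflation, while \<open>conflation_iso\<close> wants them to lead out of it; hence the
      inverses.\<close>
    have "b' \<cdot> g = b' \<cdot> (g \<cdot> c) \<cdot> c'" using dc c' b' by simp
    also have "\<dots> = g' \<cdot> c'" unfolding eq using dc c'(2,3) b' comp_reduce[OF b'(4), of "g' \<cdot> c'"] by simp
    finally have 1: "b' \<cdot> g = g' \<cdot> c'" .
    have "a' \<cdot> f = a' \<cdot> (f \<cdot> b) \<cdot> b'" using dc a' b' by simp
    also have "\<dots> = f' \<cdot> b'" unfolding eq using dc b'(2,3) a' comp_reduce[OF a'(4), of "f' \<cdot> b'"] by simp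
    finally have 2: "a' \<cdot> f = f' \<cdot> b'" .
    have "(g', f') \<in> E"
      by (rule conflation_iso[OF gf, of g' Z' Y' f' X' c' b' a'])
        (use dc a' b' c' 1 2 in auto)
    then show "(f', g') \<in> E\<inverse>" by simp
  next
    fix X assume "X \<in> Obj (opcat C)"
    then show "inflation (E\<inverse>) (Id (opcat C) X)" "deflation (E\<inverse>) (Id (opcat C) X)"
      using id_inflation id_deflation by auto
  next
    fix f g assume "Cod (opcat C) f = Dom (opcat C) g"
    then show "inflation (E\<inverse>) f \<Longrightarrow> inflation (E\<inverse>) g \<Longrightarrow> inflation (E\<inverse>) (g \<cdot>\<^bsub>opcat C\<^esub> f)"
      "deflation (E\<inverse>) f \<Longrightarrow> deflation (E\<inverse>) g \<Longrightarrow> deflation (E\<inverse>) (g \<cdot>\<^bsub>opcat C\<^esub> f)"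
      using inflation_comp[of g f] deflation_comp[of g f] by auto
  next
    fix f a
    show "\<lbrakk>inflation (E\<inverse>) f; a \<in> Arr (opcat C); Dom (opcat C) a = Dom (opcat C) f\<rbrakk>
      \<Longrightarrow> \<exists>b f'. is_pushout (opcat C) f a b f' \<and> inflation (E\<inverse>) f'"
      using deflation_pullback by simp
    show "\<lbrakk>deflation (E\<inverse>) f; a \<in> Arr (opcat C); Cod (opcat C) a = Cod (opcat C) f\<rbrakk>
      \<Longrightarrow> \<exists>b g'. is_pullback (opcat C) f a b g' \<and> deflation (E\<inverse>) g'"
      using inflation_pushout by simp
  qed
qed

lemmas conflationD = short_exactD[OF conflation_short_exact]

text \<open>The axiom yields a deflation with an unspecified kernel \<open>f''\<close>. The kernel
  \<open>f'\<close> with the prescribed domain differs from it by an isomorphism, and closure under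
  isomorphisms brings it back into \<open>E\<close>.\<close>

lemma conflation_pullback_exists:
  assumes fg: "(f, g) \<in> E" and a: "a \<in> Arr C" "Cod C a = Cod C g"
  obtains f' g' where "conflation_pullback C E a (f, g) (f', g')"
proof -
  note d = conflationD[OF fg]
  have "deflation E g" using fg by (auto simp: deflation_def)
  then obtain b g' f'' where p: "is_pullback C g a b g'" and fg': "(f'', g') \<in> E"
    using deflation_pullback a unfolding deflation_def by blast
  note d' = conflationD[OF fg']
  obtain f' where f': "is_kernel C f' g'" "Dom C f' = Dom C f" "b \<cdot> f' = f"
    using pullback_kernel[OF d(1) p] .
  obtain u where u: "is_iso C u" "Dom C u = Dom C f''" "Cod C u = Dom C f'" "f' \<cdot> u = f''"
    using kernel_unique[OF d'(1) f'(1)] .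
  have "(f', g') \<in> E"
    by (rule conflation_iso[OF fg', of f' "Dom C f'" "Dom C g'" g' "Cod C g'" u "Id C (Dom C g')" "Id C (Cod C g')"])
      (use u d' f'(1) kernelD[OF f'(1)] in \<open>auto simp: is_iso_def\<close>)
  then show thesis using that[of f' g'] p f' fg by (auto simp: conflation_pullback_def)
qed

lemma conflation_pushout_exists:
  assumes "(f, g) \<in> E" "a \<in> Arr C" "Dom C a = Dom C f"
  obtains f' g' where "conflation_pushout C E a (f, g) (f', g')"
proof -
  obtain g' f' where "conflation_pullback (opcat C) (E\<inverse>) a (g, f) (g', f')"
    using exact_category.conflation_pullback_exists[OF exact_opcat, of g f a] assms by auto
  then show thesis using that by simp
qed

section \<open>Split conflations and classes in Ext\<close>

lemma ext_zeroI:
  assumes fg: "(f, g) \<in> E" and s: "s \<in> Arr C" "Dom C s = Cod C g" "Cod C s = Dom C g" "g \<cdot> s = Id C (Cod C g)"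
  shows "(f, g) \<in> ext_zero C E (Cod C g) (Dom C f)"
proof -
  obtain r where "is_biproduct C (Dom C f) (Cod C g) (Cod C f) f s r g"
    by (rule split_biproduct[OF conflation_short_exact[OF fg] s(1,2,4,3)])
  then show ?thesis using fg by (auto simp: ext_zero_def ext_conflations_def)
qed

lemma ext_zeroE:
  assumes "(f, g) \<in> ext_zero C E Z X"
  obtains s where "(f, g) \<in> E" "Dom C f = X" "Cod C g = Z" "s \<in> Arr C" "Dom C s = Z"
    "Cod C s = Dom C g" "g \<cdot> s = Id C Z"
proof -
  obtain s r where "(f, g) \<in> E" "Dom C f = X" "Cod C g = Z"
    and b: "is_biproduct C X Z (Cod C f) f s r g"
    using assms by (auto simp: ext_zero_def ext_conflations_def)
  moreover note biproductD[OF b]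
  ultimately show thesis using that[of s] by simp
qed

lemma ext_zero_iso:
  assumes "(f, g) \<in> ext_zero C E Z X" "(f', g') \<in> ext_zero C E Z X"
  obtains h where "is_iso C h" "Dom C h = Cod C f" "Cod C h = Cod C f'" "h \<cdot> f = f'" "g' \<cdot> h = g"
  using assms biproduct_iso unfolding ext_zero_def by (smt (verit) case_prodD mem_Collect_eq)

lemma ext_zero_equiv:
  assumes "e \<in> ext_zero C E Z X" "e' \<in> ext_zero C E Z X"
  shows "(e, e') \<in> ext_equiv C E Z X"
proof -
  obtain f g f' g' where e: "e = (f, g)" "e' = (f', g')" by (cases e, cases e')
  obtain h where "is_iso C h" "Dom C h = Cod C f" "Cod C h = Cod C f'" "h \<cdot> f = f'" "g' \<cdot> h = g"
    using ext_zero_iso assms e by metis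
  then show ?thesis using assms e
    by (auto simp: ext_equiv_def ext_zero_def is_iso_def)
qed

lemma ext_carrierD:
  assumes "\<xi> \<in> carrier (Ext C E Z X)"
  obtains e where "e \<in> \<xi>" "\<xi> \<subseteq> ext_conflations C E Z X"
proof -
  obtain e where e: "e \<in> ext_conflations C E Z X" "\<xi> = ext_equiv C E Z X `` {e}"
    using assms by (auto simp: quotient_def)
  obtain f g where fg: "e = (f, g)" by (cases e)
  then have "(f, g) \<in> E" using e by (simp add: ext_conflations_def)
  note d = conflationD[OF this]
  have "(e, e) \<in> ext_equiv C E Z X"
    using e d unfolding fg ext_equiv_def by (auto intro!: bexI[of _ "Id C (Cod C f)"])
  moreover have "\<xi> \<subseteq> ext_conflations C E Z X" unfolding e by (auto simp: ext_equiv_def)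
  ultimately show thesis using that[of e] e by blast
qed

lemma ext_carrierI:
  assumes "e \<in> ext_conflations C E Z X"
  obtains \<xi> where "e \<in> \<xi>" "\<xi> \<in> carrier (Ext C E Z X)"
proof -
  obtain f g where fg: "e = (f, g)" by (cases e)
  then have "(f, g) \<in> E" using assms by (simp add: ext_conflations_def)
  note d = conflationD[OF this]
  have "(e, e) \<in> ext_equiv C E Z X"
    using assms d unfolding fg ext_equiv_def by (auto intro!: bexI[of _ "Id C (Cod C f)"])
  then show thesis using that[of "ext_equiv C E Z X `` {e}"] assms
    by (auto simp: quotient_def)
qed

text \<open>\<open>ext_vanishes\<close> compares the carrier with a singleton, so an empty carrier
  has to be excluded. A pullback along a zero arrow supplies a member.\<close>

lemma ext_conflation_exists:
  assumes "Z \<in> Obj C" "X \<in> Obj C"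
  obtains e where "e \<in> ext_conflations C E Z X"
proof -
  obtain c where c: "(Id C X, c) \<in> E" using id_inflation assms by (auto simp: inflation_def)
  note d = conflationD[OF this]
  obtain f g where fg: "conflation_pullback C E (Zero C Z (Cod C c)) (Id C X, c) (f, g)"
    using conflation_pullback_exists[OF c, of "Zero C Z (Cod C c)"] assms d by auto
  then obtain b where "is_pullback C c (Zero C Z (Cod C c)) b g" "(f, g) \<in> E" "Dom C f = X"
    using assms by (auto simp: conflation_pullback_def)
  then show thesis using that[of "(f, g)"] assms pullbackD(7)[of c _ b g] d
    by (auto simp: ext_conflations_def)
qed

text \<open>Uniqueness of biproducts puts all split conflations into a single class. Vanishing of
  the group thus becomes a statement about individual conflations, with no reference to the Baer
  sum.\<close>

lemma ext_vanishes_iff: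
  assumes "Z \<in> Obj C" "X \<in> Obj C"
  shows "ext_vanishes C E Z X \<longleftrightarrow> ext_conflations C E Z X \<subseteq> ext_zero C E Z X"
proof
  assume v: "ext_vanishes C E Z X"
  show "ext_conflations C E Z X \<subseteq> ext_zero C E Z X"
  proof
    fix e assume "e \<in> ext_conflations C E Z X"
    then obtain \<xi> where "e \<in> \<xi>" "\<xi> \<in> carrier (Ext C E Z X)" by (rule ext_carrierI)
    then show "e \<in> ext_zero C E Z X" using v by (simp add: ext_vanishes_def)
  qed
next
  assume sub: "ext_conflations C E Z X \<subseteq> ext_zero C E Z X"
  have sub': "ext_zero C E Z X \<subseteq> ext_conflations C E Z X" by (auto simp: ext_zero_def)
  have "ext_equiv C E Z X `` {e} = ext_zero C E Z X" if "e \<in> ext_conflations C E Z X" for e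
  proof
    show "ext_equiv C E Z X `` {e} \<subseteq> ext_zero C E Z X" using sub by (auto simp: ext_equiv_def)
    show "ext_zero C E Z X \<subseteq> ext_equiv C E Z X `` {e}" using ext_zero_equiv sub that by blast
  qed
  moreover obtain e where "e \<in> ext_conflations C E Z X" using ext_conflation_exists[OF assms] .
  ultimately have "carrier (Ext C E Z X) = {ext_zero C E Z X}"
    by (auto simp: quotient_def)
  then show "ext_vanishes C E Z X" by (simp add: ext_vanishes_def)
qed

text \<open>Sections of the pulled-back deflation correspond to lifts of \<open>i\<close> along
  \<open>g\<close>, by the universal property applied to the lift and an identity. This is the
  bridge between Ext and lifting.\<close>

lemma pullback_section_iff:
  assumes "conflation_pullback C E i (f, g) (f', g')"
  shows "(\<exists>s\<in>Arr C. Dom C s = Cod C g' \<and> Cod C s = Dom C g' \<and> g' \<cdot> s = Id C (Cod C g')) \<longleftrightarrow>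
    (\<exists>u\<in>Arr C. Dom C u = Dom C i \<and> Cod C u = Dom C g \<and> g \<cdot> u = i)" (is "?L \<longleftrightarrow> ?R")
proof -
  obtain b where p: "is_pullback C g i b g'" using assms by (auto simp: conflation_pullback_def)
  note pd = pullbackD[OF p]
  show ?thesis
  proof
    assume ?L
    then obtain s where s: "s \<in> Arr C" "Dom C s = Cod C g'" "Cod C s = Dom C g'" "g' \<cdot> s = Id C (Cod C g')"
      by blast
    have "g \<cdot> b \<cdot> s = i" using comp_reduce[OF pd(9), of s] pd s by simp
    then show ?R using pd s by (intro bexI[of _ "b \<cdot> s"]) auto
  next
    assume ?R
    then obtain u where u: "u \<in> Arr C" "Dom C u = Dom C i" "Cod C u = Dom C g" "g \<cdot> u = i" by blast
    obtain s where "s \<in> Arr C" "Dom C s = Dom C u" "Cod C s = Dom C b" "g' \<cdot> s = Id C (Dom C i)"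
      by (rule pullbackE[OF p, of u "Id C (Dom C i)"]) (use u pd in auto)
    then show ?L using pd u by (intro bexI[of _ s]) auto
  qed
qed

section \<open>The ideal of the projectives\<close>

abbreviation proj :: "'o set" where "proj \<equiv> exact_projectives C E"

lemma proj_ideal_lift:
  assumes "i \<in> ideal_of C proj" "(f, g) \<in> E" "Cod C g = Cod C i"
  obtains u where "u \<in> Arr C" "Dom C u = Dom C i" "Cod C u = Dom C g" "g \<cdot> u = i"
proof -
  obtain n m where i: "i = m \<cdot> n" "n \<in> Arr C" "m \<in> Arr C" "Cod C n = Dom C m" "Cod C n \<in> proj"
    using ideal_ofE[OF assms(1)] .
  have "m \<in> Hom C (Cod C n) (Cod C g)" using i assms by auto
  then obtain u where "u \<in> Hom C (Cod C n) (Dom C g)" "g \<cdot> u = m"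
    using i(5) assms(2) unfolding exact_projectives_def by fast
  then show thesis using that[of "u \<cdot> n"] i comp_reduce[of g u m n] conflationD[OF assms(2)] by auto
qed

text \<open>An arrow through a projective lifts along every deflation onto its codomain, so the
  pullback along \<open>i\<close> splits already. The pushout inherits the section
  \<open>b' \<cdot> s\<close>, whatever \<open>j\<close> is.\<close>

lemma proj_ideal_ext_map_vanishes:
  assumes i: "i \<in> ideal_of C proj" and j: "j \<in> Arr C"
  shows "ext_map_vanishes C E i j"
  unfolding ext_map_vanishes_def
proof
  have ia: "i \<in> Arr C" using i by (auto simp: ideal_of_def)
  fix \<xi> assume \<xi>: "\<xi> \<in> carrier (Ext C E (Cod C i) (Dom C j))"
  have split: "e'' \<in> ext_zero C E (Dom C i) (Cod C j)"
    if prem: "e \<in> \<xi>" "conflation_pullback C E i e e'" "conflation_pushout C E j e' e''" for e e' e''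
  proof -
    obtain f g f' g' f'' g'' where e: "e = (f, g)" "e' = (f', g')" "e'' = (f'', g'')"
      by (cases e, cases e', cases e'')
    have fg: "(f, g) \<in> E" "Cod C g = Cod C i" "Dom C f = Dom C j"
      using prem(1) \<xi> e ext_carrierD[OF \<xi>] by (auto simp: ext_conflations_def)
    obtain u where "u \<in> Arr C" "Dom C u = Dom C i" "Cod C u = Dom C g" "g \<cdot> u = i"
      using proj_ideal_lift[OF i fg(1,2)] .
    then obtain s where s: "s \<in> Arr C" "Dom C s = Cod C g'" "Cod C s = Dom C g'" "g' \<cdot> s = Id C (Cod C g')"
      using pullback_section_iff[of i f g f' g'] prem(2) e by auto
    obtain b where b: "is_pullback C g i b g'" using prem(2) e by (auto simp: conflation_pullback_def)
    obtain b' where b': "is_pushout C f' j b' f''" "g'' \<cdot> b' = g'" "Cod C g'' = Cod C g'"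
      and fg': "(f', g') \<in> E" and fg'': "(f'', g'') \<in> E"
      using prem(3) e by (auto simp: conflation_pushout_def)
    have po: "b' \<in> Arr C" "Dom C b' = Cod C f'" "Dom C f'' = Cod C j" "Cod C b' = Cod C f''"
      using b' by (auto simp: is_pushout_def)
    note d = conflationD[OF fg'] conflationD[OF fg''] pullbackD[OF b]
    have "(f'', g'') \<in> ext_zero C E (Cod C g'') (Dom C f'')"
      by (rule ext_zeroI[OF fg'', of "b' \<cdot> s"])
        (use d(1-16) po s b'(3) comp_reduce[OF b'(2), of s] in auto)
    then show ?thesis using e po b'(3) d by simp
  qed
  obtain e where e: "e \<in> \<xi>" "\<xi> \<subseteq> ext_conflations C E (Cod C i) (Dom C j)" using ext_carrierD[OF \<xi>] .
  obtain f g where fg: "e = (f, g)" by (cases e)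
  have fgE: "(f, g) \<in> E" "Cod C g = Cod C i" "Dom C f = Dom C j"
    using e fg by (auto simp: ext_conflations_def)
  obtain f' g' where e': "conflation_pullback C E i (f, g) (f', g')"
    using conflation_pullback_exists[OF fgE(1) ia] fgE(2) by auto
  then have fg': "(f', g') \<in> E" "Dom C f' = Dom C j" using fgE by (auto simp: conflation_pullback_def)
  obtain f'' g'' where e'': "conflation_pushout C E j (f', g') (f'', g'')"
    using conflation_pushout_exists[OF fg'(1) j] fg'(2) by auto
  have z: "(f'', g'') \<in> ext_zero C E (Dom C i) (Cod C j)" using split e' e'' e(1) fg by blast
  have "ext_map C E i j \<xi> = ext_zero C E (Dom C i) (Cod C j)"
  proof
    show "ext_map C E i j \<xi> \<subseteq> ext_zero C E (Dom C i) (Cod C j)"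
      using split by (auto simp: ext_map_def ext_push_def ext_pull_def)
    \<comment> \<open>\<open>ext_map\<close> collects all representatives, so every split conflation
      must be exhibited as a pushout. It is isomorphic to the one just constructed, and the pushout
      square is carried along that isomorphism.\<close>
    show "ext_zero C E (Dom C i) (Cod C j) \<subseteq> ext_map C E i j \<xi>"
    proof
      fix e0 assume e0: "e0 \<in> ext_zero C E (Dom C i) (Cod C j)"
      obtain f0 g0 where fg0: "e0 = (f0, g0)" by (cases e0)
      obtain h where h: "is_iso C h" "Dom C h = Cod C f''" "Cod C h = Cod C f0" "h \<cdot> f'' = f0" "g0 \<cdot> h = g''"
        using ext_zero_iso[OF z] e0 fg0 by blast
      have E0: "(f0, g0) \<in> E" "Cod C g0 = Dom C i" using e0 fg0 by (auto simp: ext_zero_def ext_conflations_def)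
      have E'': "(f'', g'') \<in> E" "Cod C g'' = Dom C i" using z by (auto simp: ext_zero_def ext_conflations_def)
      obtain b' where b': "is_pushout C f' j b' f''" "g'' \<cdot> b' = g'" "Cod C g'' = Cod C g'"
        using e'' by (auto simp: conflation_pushout_def)
      have po: "b' \<in> Arr C" "Dom C b' = Cod C f'" "Dom C f'' = Cod C j" "Cod C b' = Cod C f''"
        using b' by (auto simp: is_pushout_def)
      have "is_pushout C f' j (h \<cdot> b') f0"
        using preadditive_category.pullback_iso[OF preadditive_opcat, of f' j b' f'' h "h \<cdot> b'" f0]
          b' h po by simp
      moreover have "g0 \<cdot> h \<cdot> b' = g'"
        using comp_reduce[OF h(5), of b'] h po b' conflationD[OF E0(1)] by (simp add: is_iso_def)
      ultimately have "conflation_pushout C E j (f', g') (f0, g0)"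
        using fg' E0 E'' b' by (auto simp: conflation_pushout_def)
      then show "e0 \<in> ext_map C E i j \<xi>"
        using e' e(1) fg fg0 by (auto simp: ext_map_def ext_push_def ext_pull_def)
    qed
  qed
  then show "ext_map C E i j \<xi> = \<one>\<^bsub>Ext C E (Dom C i) (Cod C j)\<^esub>" by simp
qed

lemma conflation_pushout_Id:
  assumes "(f, g) \<in> E"
  shows "conflation_pushout C E (Id C (Dom C f)) (f, g) (f, g)"
    and conflation_pullback_Id: "conflation_pullback C E (Id C (Cod C g)) (f, g) (f, g)"
  using preadditive_category.pullback_Id[OF preadditive_opcat, of f] pullback_Id[of g]
    conflationD[OF assms] assms
  unfolding conflation_pushout_def conflation_pullback_def by force+

text \<open>Pushing out along the identity of the kernel changes nothing, so vanishing there says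
  that the pullback along \<open>i\<close> splits, which amounts to a lift of
  \<open>i\<close>.\<close>

lemma ext_map_vanishes_lift:
  assumes "i \<in> Arr C" "(f, g) \<in> E" "Cod C g = Cod C i" "ext_map_vanishes C E i (Id C (Dom C f))"
  obtains u where "u \<in> Arr C" "Dom C u = Dom C i" "Cod C u = Dom C g" "g \<cdot> u = i"
proof -
  note d = conflationD[OF assms(2)]
  obtain f' g' where e': "conflation_pullback C E i (f, g) (f', g')"
    using conflation_pullback_exists[OF assms(2,1)] assms(3) by auto
  then have fg': "(f', g') \<in> E" "Dom C f' = Dom C f" by (auto simp: conflation_pullback_def)
  obtain \<xi> where \<xi>: "(f, g) \<in> \<xi>" "\<xi> \<in> carrier (Ext C E (Cod C i) (Dom C f))"
    by (rule ext_carrierI[of "(f, g)" "Cod C i" "Dom C f"])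
      (use assms in \<open>auto simp: ext_conflations_def\<close>)
  have "(f', g') \<in> ext_map C E i (Id C (Dom C f)) \<xi>"
    using \<xi>(1) e' conflation_pushout_Id[OF fg'(1)] fg'(2)
    by (auto simp: ext_map_def ext_push_def ext_pull_def)
  also have "ext_map C E i (Id C (Dom C f)) \<xi> = ext_zero C E (Dom C i) (Dom C f)"
    using assms(4) \<xi>(2) d unfolding ext_map_vanishes_def by simp
  finally obtain s where "s \<in> Arr C" "Dom C s = Cod C g'" "Cod C s = Dom C g'" "g' \<cdot> s = Id C (Cod C g')"
    by (rule ext_zeroE) auto
  then show thesis using pullback_section_iff[OF e'] that by blast
qed

lemma proj_Obj: "proj \<subseteq> Obj C"
  by (auto simp: exact_projectives_def)

lemma projI:
  assumes "P \<in> Obj C" "\<And>f g h. \<lbrakk>(f, g) \<in> E; h \<in> Arr C; Dom C h = P; Cod C h = Cod C g\<rbrakk>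
    \<Longrightarrow> \<exists>u. u \<in> Arr C \<and> Dom C u = P \<and> Cod C u = Dom C g \<and> g \<cdot> u = h"
  shows "P \<in> proj"
proof -
  have "\<exists>u \<in> Hom C P (Dom C g). g \<cdot> u = h" if fgh: "(f, g) \<in> E" "h \<in> Hom C P (Cod C g)" for f g h
  proof -
    obtain u where "u \<in> Arr C \<and> Dom C u = P \<and> Cod C u = Dom C g \<and> g \<cdot> u = h"
      using assms(2)[of f g h] fgh by auto
    then show ?thesis by (intro bexI[of _ u]) auto
  qed
  then show ?thesis using assms(1) unfolding exact_projectives_def by blast
qed

lemma projE:
  assumes "P \<in> proj" "(f, g) \<in> E" "h \<in> Arr C" "Dom C h = P" "Cod C h = Cod C g"
  obtains u where "u \<in> Arr C" "Dom C u = P" "Cod C u = Dom C g" "g \<cdot> u = h"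
proof -
  have "h \<in> Hom C P (Cod C g)" using assms by simp
  then obtain u where "u \<in> Hom C P (Dom C g)" "g \<cdot> u = h"
    using assms(1,2) unfolding exact_projectives_def by fast
  then show thesis using that by auto
qed

lemma zero_proj:
  assumes Z: "is_zero_object C Z"
  shows "Z \<in> proj"
proof (rule projI)
  show Z': "Z \<in> Obj C" using Z by (simp add: is_zero_object_def)
  fix f g h assume *: "(f, g) \<in> E" "h \<in> Arr C" "Dom C h = Z" "Cod C h = Cod C g"
  note d = conflationD[OF *(1)]
  have "g \<cdot> Zero C Z (Dom C g) = h"
    by (rule zero_arr[OF Z]) (use d * Z' in auto)
  then show "\<exists>u. u \<in> Arr C \<and> Dom C u = Z \<and> Cod C u = Dom C g \<and> g \<cdot> u = h"
    using d Z' by (intro exI[of _ "Zero C Z (Dom C g)"]) auto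
qed

lemma biproduct_proj:
  assumes "X \<in> proj" "Y \<in> proj" and b: "is_biproduct C X Y S i j p q"
  shows "S \<in> proj"
proof (rule projI)
  note bd = biproductD[OF b]
  show "S \<in> Obj C" by fact
  fix f g h assume *: "(f, g) \<in> E" "h \<in> Arr C" "Dom C h = S" "Cod C h = Cod C g"
  note d = conflationD[OF *(1)]
  obtain u where u: "u \<in> Arr C" "Dom C u = X" "Cod C u = Dom C g" "g \<cdot> u = h \<cdot> i"
    by (rule projE[OF assms(1) *(1), of "h \<cdot> i"]) (use bd * in auto)
  obtain v where v: "v \<in> Arr C" "Dom C v = Y" "Cod C v = Dom C g" "g \<cdot> v = h \<cdot> j"
    by (rule projE[OF assms(2) *(1), of "h \<cdot> j"]) (use bd * in auto)
  have "g \<cdot> (u \<cdot> p \<boxplus> v \<cdot> q) = h \<cdot> i \<cdot> p \<boxplus> h \<cdot> j \<cdot> q"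
    using u v d bd * comp_reduce[OF u(4), of p] comp_reduce[OF v(4), of q] by simp
  also have "\<dots> = h \<cdot> (i \<cdot> p \<boxplus> j \<cdot> q)" using bd(1-15) * by simp
  also have "\<dots> = h" using bd * by (simp del: distrib)
  finally show "\<exists>u. u \<in> Arr C \<and> Dom C u = S \<and> Cod C u = Dom C g \<and> g \<cdot> u = h"
    using u v bd by (intro exI[of _ "u \<cdot> p \<boxplus> v \<cdot> q"]) simp
qed

text \<open>If an identity factors through a projective, its object is a retract of that projective.
  Lifting along a deflation passes to retracts even when no complementary summand exists, as can
  happen in A.\<close>

lemma ideal_objects_proj_ideal: "ideal_objects C (ideal_of C proj) = proj"
proof
  show "ideal_objects C (ideal_of C proj) \<subseteq> proj"
  proof
    fix X assume X: "X \<in> ideal_objects C (ideal_of C proj)"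
    then have X': "X \<in> Obj C" "Id C X \<in> ideal_of C proj" by (auto simp: ideal_objects_def)
    obtain n m where i: "Id C X = m \<cdot> n" "n \<in> Arr C" "m \<in> Arr C" "Cod C n = Dom C m" "Cod C n \<in> proj"
      using ideal_ofE[OF X'(2)] .
    have nm: "Dom C n = X" "Cod C m = X" using i comp_simps[of n m] X' by (metis Id_simps)+
    show "X \<in> proj"
    proof (rule projI)
      fix f g h assume *: "(f, g) \<in> E" "h \<in> Arr C" "Dom C h = X" "Cod C h = Cod C g"
      note d = conflationD[OF *(1)]
      obtain u where u: "u \<in> Arr C" "Dom C u = Cod C n" "Cod C u = Dom C g" "g \<cdot> u = h \<cdot> m"
        by (rule projE[OF i(5) *(1), of "h \<cdot> m"]) (use i nm * in auto)
      have "g \<cdot> u \<cdot> n = h" using comp_reduce[OF u(4), of n] u i(2-4) i(1)[symmetric] nm d * by simp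
      then show "\<exists>u. u \<in> Arr C \<and> Dom C u = X \<and> Cod C u = Dom C g \<and> g \<cdot> u = h"
        using u i nm by (intro exI[of _ "u \<cdot> n"]) auto
    qed (fact X')
  qed
  show "proj \<subseteq> ideal_objects C (ideal_of C proj)"
  proof
    fix X assume X: "X \<in> proj"
    then have X': "X \<in> Obj C" using proj_Obj by blast
    then have "Id C X \<cdot> Id C X \<in> ideal_of C proj" using X by (intro ideal_ofI) auto
    then show "X \<in> ideal_objects C (ideal_of C proj)" using X' by (simp add: ideal_objects_def)
  qed
qed

lemma mor_ideal_proj: "mor_ideal C (ideal_of C proj)"
proof -
  obtain Z where "is_zero_object C Z" using zero_object by blast
  then have "Z \<in> proj" by (rule zero_proj)
  then show ?thesis
  proof (rule mor_ideal_ideal_of[OF _ proj_Obj])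
    fix X Y assume "X \<in> proj" "Y \<in> proj"
    then show "\<exists>S i j p q. S \<in> proj \<and> is_biproduct C X Y S i j p q"
      using biproducts biproduct_proj proj_Obj by (meson subsetD)
  qed
qed

text \<open>The hypothesis is the ideal form of having enough projectives: the deflation factors
  through a projective while its domain may fail to be one.\<close>

theorem proj_ideal_cotorsion:
  assumes enough: "\<And>Z. Z \<in> Obj C \<Longrightarrow> \<exists>f g. (f, g) \<in> E \<and> Cod C g = Z \<and> g \<in> ideal_of C proj"
  shows "complete_ideal_cotorsion_pair C E (ideal_of C proj) (ideal_of C (Obj C))"
    and "cotorsion_pair C E proj (Obj C)"
proof -
  let ?I = "ideal_of C proj"
  have left: "ideal_left_perp C E (Arr C) = ?I"
  proof
    show "?I \<subseteq> ideal_left_perp C E (Arr C)"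
      using proj_ideal_ext_map_vanishes mor_ideal_proj
      by (auto simp: ideal_left_perp_def mor_ideal_def)
    show "ideal_left_perp C E (Arr C) \<subseteq> ?I"
    proof
      fix i assume "i \<in> ideal_left_perp C E (Arr C)"
      then have i: "i \<in> Arr C" "\<And>j. j \<in> Arr C \<Longrightarrow> ext_map_vanishes C E i j"
        by (auto simp: ideal_left_perp_def)
      obtain f g where fg: "(f, g) \<in> E" "Cod C g = Cod C i" "g \<in> ?I" using enough i by (metis Cod_obj)
      note d = conflationD[OF fg(1)]
      \<comment> \<open>Orthogonality to the identity of \<open>Dom C f\<close> alone lifts
        \<open>i\<close> along \<open>g\<close>, and the ideal absorbs the composite.\<close>
      obtain u where u: "u \<in> Arr C" "Dom C u = Dom C i" "Cod C u = Dom C g" "g \<cdot> u = i"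
        using ext_map_vanishes_lift[OF i(1) fg(1,2)] i(2) d by auto
      then show "i \<in> ?I" using mor_idealD(3)[OF mor_ideal_proj fg(3)] fg by metis
    qed
  qed
  have right: "ideal_right_perp C E ?I = Arr C"
    using proj_ideal_ext_map_vanishes by (auto simp: ideal_right_perp_def)
  have mArr: "mor_ideal C (Arr C)" by (auto simp: mor_ideal_def)
  have "special_precovering_ideal C E ?I"
    unfolding special_precovering_ideal_def special_precover_def right
  proof
    fix Z assume "Z \<in> Obj C"
    then obtain f g where fg: "(f, g) \<in> E" "Cod C g = Z" "g \<in> ?I" using enough by blast
    note d = conflationD[OF fg(1)]
    \<comment> \<open>All arrows lie in the right orthogonal, so the conflation can be taken as its
      own pushout along an identity.\<close>
    have "conflation_pushout C E (Id C (Dom C f)) (f, g) (f, g)"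
      using conflation_pushout_Id fg by blast
    then show "\<exists>i. i \<in> ?I \<and> Cod C i = Z \<and> (\<exists>k e. \<exists>j\<in>Arr C. conflation_pushout C E j e (k, i))"
      using fg d by (metis Id_simps(1) Dom_obj)
  qed
  moreover have "special_preenveloping_ideal C E (Arr C)"
    unfolding special_preenveloping_ideal_def special_preenvelope_def left
  proof
    fix Z assume Z: "Z \<in> Obj C"
    \<comment> \<open>The preenvelope is the identity of \<open>Z\<close>. Its cokernel
      \<open>c\<close> is both zero and epic, so the identity of \<open>Cod C c\<close> is a zero
      arrow and lies in the ideal.\<close>
    obtain c where c: "(Id C Z, c) \<in> E" using id_inflation Z by (auto simp: inflation_def)
    note d = conflationD[OF c]
    have c0: "c = Zero C Z (Cod C c)" using d Z by simp
    have "Id C (Cod C c) \<cdot> c = Zero C (Cod C c) (Cod C c) \<cdot> c" using c0 d Z by simp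
    then have "Id C (Cod C c) = Zero C (Cod C c) (Cod C c)"
      using d by - (rule epic_cancel[OF d(4)], auto)
    then have "Id C (Cod C c) \<in> ?I" using mor_ideal_proj d unfolding mor_ideal_def by simp
    moreover have "conflation_pullback C E (Id C (Cod C c)) (Id C Z, c) (Id C Z, c)"
      using conflation_pullback_Id c by blast
    ultimately show "\<exists>j. j \<in> Arr C \<and> Dom C j = Z \<and> (\<exists>c e. \<exists>i\<in>?I. conflation_pullback C E i e (j, c))"
      using Z by (metis Id_simps(1,2))
  qed
  ultimately show "complete_ideal_cotorsion_pair C E ?I (ideal_of C (Obj C))"
    using mor_ideal_proj mArr left right
    by (simp add: complete_ideal_cotorsion_pair_def ideal_cotorsion_pair_def ideal_of_Obj)
  have van: "ext_vanishes C E P X" if P: "P \<in> proj" and X: "X \<in> Obj C" for P X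
  proof -
    have P': "P \<in> Obj C" using P proj_Obj by blast
    have "(f, g) \<in> ext_zero C E P X" if fg: "(f, g) \<in> ext_conflations C E P X" for f g
    proof -
      have fg': "(f, g) \<in> E" "Cod C g = P" "Dom C f = X" using fg by (auto simp: ext_conflations_def)
      obtain s where "s \<in> Arr C" "Dom C s = P" "Cod C s = Dom C g" "g \<cdot> s = Id C P"
        by (rule projE[OF P fg'(1), of "Id C P"]) (use P' fg' in auto)
      then show ?thesis using ext_zeroI[OF fg'(1), of s] fg' by auto
    qed
    then show ?thesis using ext_vanishes_iff[OF P' X] by auto
  qed
  have "left_perp C E (Obj C) \<subseteq> proj"
  proof
    fix X assume "X \<in> left_perp C E (Obj C)"
    then have X: "X \<in> Obj C" "\<And>Y. Y \<in> Obj C \<Longrightarrow> ext_vanishes C E X Y" by (auto simp: left_perp_def)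
    obtain f g where fg: "(f, g) \<in> E" "Cod C g = X" "g \<in> ?I" using enough X by blast
    note d = conflationD[OF fg(1)]
    have "(f, g) \<in> ext_conflations C E X (Dom C f)" using fg by (simp add: ext_conflations_def)
    then have "(f, g) \<in> ext_zero C E X (Dom C f)"
      using ext_vanishes_iff[OF X(1), of "Dom C f"] X(2)[of "Dom C f"] d by auto
    then obtain s where s: "s \<in> Arr C" "Dom C s = X" "Cod C s = Dom C g" "g \<cdot> s = Id C X"
      by (rule ext_zeroE)
    \<comment> \<open>The deflation from the ideal splits, and its section pulls the identity of
      \<open>X\<close> into the ideal, although \<open>Dom C g\<close> itself need not be
      projective.\<close>
    then have "Id C X \<in> ?I" using mor_idealD(3)[OF mor_ideal_proj fg(3)] fg by metis
    then have "X \<in> ideal_objects C ?I" using X by (simp add: ideal_objects_def)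
    then show "X \<in> proj" by (simp add: ideal_objects_proj_ideal)
  qed
  then show "cotorsion_pair C E proj (Obj C)"
    using van proj_Obj by (auto simp: cotorsion_pair_def left_perp_def right_perp_def)
qed

end

section \<open>Full subcategories\<close>

lemma full_subcategory_simps [simp]:
  "Obj (full_subcategory C S) = Obj C \<inter> S"
  "f \<in> Arr (full_subcategory C S) \<longleftrightarrow> f \<in> Arr C \<and> Dom C f \<in> S \<and> Cod C f \<in> S"
  "Dom (full_subcategory C S) = Dom C" "Cod (full_subcategory C S) = Cod C"
  "Id (full_subcategory C S) = Id C" "Comp (full_subcategory C S) = Comp C"
  "Add (full_subcategory C S) = Add C" "Zero (full_subcategory C S) = Zero C"
  by (auto simp: full_subcategory_def)

lemma full_subcategory_Hom:
  "\<lbrakk>X \<in> S; Y \<in> S\<rbrakk> \<Longrightarrow> Hom (full_subcategory C S) X Y = Hom C X Y"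
  by (auto simp: Hom_def)

lemma full_subcategory_opcat: "full_subcategory (opcat C) S = opcat (full_subcategory C S)"
  by (cases C) (auto simp: full_subcategory_def opcat_def)

lemma (in preadditive_category) full_subcategory_preadditive:
  "preadditive_category (full_subcategory C S)"
proof (rule preadditive_category.intro)
  fix X Y assume XY: "X \<in> Obj (full_subcategory C S)" "Y \<in> Obj (full_subcategory C S)"
  then have "hom_group (full_subcategory C S) X Y = hom_group C X Y"
    by (simp add: hom_group_def full_subcategory_Hom del: Hom_iff)
  then show "comm_group (hom_group (full_subcategory C S) X Y)" using XY hom_comm_group by simp
qed auto

lemma (in preadditive_category) full_subcategory_biproduct:
  "is_biproduct (full_subcategory C S) X Y W i j p q \<longleftrightarrow>
    is_biproduct C X Y W i j p q \<and> X \<in> S \<and> Y \<in> S \<and> W \<in> S"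
  unfolding is_biproduct_def by auto

lemma (in additive_category) full_subcategory_additive:
  assumes Z: "is_zero_object C Z" "Z \<in> S"
    and bi: "\<And>X Y W i j p q. \<lbrakk>X \<in> S; Y \<in> S; is_biproduct C X Y W i j p q\<rbrakk> \<Longrightarrow> W \<in> S"
  shows "additive_category (full_subcategory C S)"
proof -
  interpret full: preadditive_category "full_subcategory C S" by (fact full_subcategory_preadditive)
  show ?thesis
  proof
    have "is_zero_object (full_subcategory C S) Z"
      using Z by (auto simp: is_zero_object_def full_subcategory_Hom simp del: Hom_iff)
    then show "\<exists>Z. is_zero_object (full_subcategory C S) Z" ..
    fix X Y assume "X \<in> Obj (full_subcategory C S)" "Y \<in> Obj (full_subcategory C S)"
    then have XY: "X \<in> Obj C" "X \<in> S" "Y \<in> Obj C" "Y \<in> S" by auto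
    obtain W i j p q where W: "is_biproduct C X Y W i j p q" using biproducts[OF XY(1,3)] by blast
    have "is_biproduct (full_subcategory C S) X Y W i j p q"
      using W bi[OF XY(2,4) W] XY by (simp add: full_subcategory_biproduct)
    then show "\<exists>W i j p q. is_biproduct (full_subcategory C S) X Y W i j p q" by blast
  qed
qed

context preadditive_category
begin

lemma full_subcategory_kernel:
  assumes k: "is_kernel C k f" and S: "Dom C k \<in> S" "Dom C f \<in> S" "Cod C f \<in> S"
  shows "is_kernel (full_subcategory C S) k f"
proof -
  interpret F: preadditive_category "full_subcategory C S" by (fact full_subcategory_preadditive)
  note kd = kernelD[OF k]
  show ?thesis
  proof (rule F.kernelI)
    show "monic (full_subcategory C S) k"
      by (rule F.monicI) (use kd S monic_cancel_Zero[OF kernel_monic[OF k]] in auto)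
    fix h assume h: "h \<in> Arr (full_subcategory C S)"
      "Cod (full_subcategory C S) h = Dom (full_subcategory C S) f"
      "f \<cdot>\<^bsub>full_subcategory C S\<^esub> h =
        Zero (full_subcategory C S) (Dom (full_subcategory C S) h) (Cod (full_subcategory C S) f)"
    obtain u where "u \<in> Arr C" "Dom C u = Dom C h" "Cod C u = Dom C k" "k \<cdot> u = h"
      by (rule kernelE[OF k, of h]) (use h in auto)
    then show "\<exists>u. u \<in> Arr (full_subcategory C S) \<and>
        Dom (full_subcategory C S) u = Dom (full_subcategory C S) h \<and>
        Cod (full_subcategory C S) u = Dom (full_subcategory C S) k \<and>
        k \<cdot>\<^bsub>full_subcategory C S\<^esub> u = h"
      using h S by auto
  qed (use kd S in auto)
qed

lemma full_subcategory_short_exact: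
  assumes s: "short_exact C f g" and S: "Dom C f \<in> S" "Cod C f \<in> S" "Cod C g \<in> S"
  shows "short_exact (full_subcategory C S) f g"
proof -
  note d = short_exactD[OF s]
  have "is_kernel (full_subcategory C S) f g"
    using full_subcategory_kernel[OF d(1)] d S by simp
  \<comment> \<open>Forming full subcategories commutes with \<open>opcat\<close>, so the cokernel
    half is the kernel half for the opposite category.\<close>
  moreover have "is_kernel (full_subcategory (opcat C) S) g f"
    using preadditive_category.full_subcategory_kernel[OF preadditive_opcat, of g f S] d S by simp
  ultimately show ?thesis by (simp add: short_exact_def full_subcategory_opcat)
qed

lemma full_subcategory_pullback:
  assumes p: "is_pullback C g a b g'" and S: "Dom C g \<in> S" "Cod C g \<in> S" "Dom C a \<in> S" "Dom C b \<in> S"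
  shows "is_pullback (full_subcategory C S) g a b g'"
proof -
  interpret F: preadditive_category "full_subcategory C S" by (fact full_subcategory_preadditive)
  note pd = pullbackD[OF p]
  show ?thesis
  proof (rule F.pullbackI)
    fix u v
    assume uv: "u \<in> Arr (full_subcategory C S)" "v \<in> Arr (full_subcategory C S)"
      "Dom (full_subcategory C S) u = Dom (full_subcategory C S) v"
      "Cod (full_subcategory C S) u = Dom (full_subcategory C S) g"
      "Cod (full_subcategory C S) v = Dom (full_subcategory C S) a"
      "g \<cdot>\<^bsub>full_subcategory C S\<^esub> u = a \<cdot>\<^bsub>full_subcategory C S\<^esub> v"
    obtain w where "w \<in> Arr C" "Dom C w = Dom C u" "Cod C w = Dom C b" "b \<cdot> w = u" "g' \<cdot> w = v"
      by (rule pullbackE[OF p, of u v]) (use uv in auto)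
    then show "\<exists>w. w \<in> Arr (full_subcategory C S) \<and>
        Dom (full_subcategory C S) w = Dom (full_subcategory C S) v \<and>
        Cod (full_subcategory C S) w = Dom (full_subcategory C S) b \<and>
        b \<cdot>\<^bsub>full_subcategory C S\<^esub> w = u \<and> g' \<cdot>\<^bsub>full_subcategory C S\<^esub> w = v"
      using uv S pd by auto
  next
    fix u v
    assume "u \<in> Arr (full_subcategory C S)" "v \<in> Arr (full_subcategory C S)"
      "Dom (full_subcategory C S) u = Dom (full_subcategory C S) v"
      "Cod (full_subcategory C S) u = Dom (full_subcategory C S) b"
      "Cod (full_subcategory C S) v = Dom (full_subcategory C S) b"
      "b \<cdot>\<^bsub>full_subcategory C S\<^esub> u = b \<cdot>\<^bsub>full_subcategory C S\<^esub> v"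
      "g' \<cdot>\<^bsub>full_subcategory C S\<^esub> u = g' \<cdot>\<^bsub>full_subcategory C S\<^esub> v"
    then show "u = v" by - (rule pullback_eq[OF p], auto)
  qed (use pd S in auto)
qed

end

lemma full_subcategory_iso: "is_iso (full_subcategory C S) f \<Longrightarrow> is_iso C f"
  unfolding is_iso_def by auto

section \<open>Additive functions on abelian categories\<close>

text \<open>These assumptions are self-dual, which lets the axioms for inflations follow from those
  for deflations. The conditions on projectives are not self-dual and enter only afterwards.\<close>

locale additive_function = abelian_category C for C :: "('o, 'm) precat" (structure) +
  fixes lam :: "'o \<Rightarrow> int"
  assumes lam_additive: "short_exact C f g \<Longrightarrow> lam (Cod C f) = lam (Dom C f) + lam (Cod C g)"
begin

definition nonneg_cat :: "('o, 'm) precat" where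
  "nonneg_cat = full_subcategory C {M \<in> Obj C. 0 \<le> lam M}"

definition nonneg_conflations :: "('m \<times> 'm) set" where
  "nonneg_conflations = induced_conflations C (Obj nonneg_cat)"

lemma nonneg_simps [simp]:
  "X \<in> Obj nonneg_cat \<longleftrightarrow> X \<in> Obj C \<and> 0 \<le> lam X"
  "f \<in> Arr nonneg_cat \<longleftrightarrow> f \<in> Arr C \<and> 0 \<le> lam (Dom C f) \<and> 0 \<le> lam (Cod C f)"
  "Dom nonneg_cat = Dom C" "Cod nonneg_cat = Cod C" "Id nonneg_cat = Id C"
  "Comp nonneg_cat = Comp C" "Add nonneg_cat = Add C" "Zero nonneg_cat = Zero C"
  by (auto simp: nonneg_cat_def)

lemma nonneg_conflations_iff:
  "(f, g) \<in> nonneg_conflations \<longleftrightarrow>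
    short_exact C f g \<and> 0 \<le> lam (Dom C f) \<and> 0 \<le> lam (Cod C f) \<and> 0 \<le> lam (Cod C g)"
  using short_exactD[of f g] by (auto simp: nonneg_conflations_def induced_conflations_def)

lemma additive_function_opcat: "additive_function (opcat C) lam"
proof -
  interpret op: abelian_category "opcat C" by (fact abelian_opcat)
  show ?thesis by unfold_locales (use lam_additive short_exactD(7) in fastforce)
qed

text \<open>With these equations the theorems about deflations, instantiated at the opposite
  category, unfold into their counterparts for inflations.\<close>

lemma opcat_nonneg:
  "additive_function.nonneg_cat (opcat C) lam = opcat nonneg_cat"
  "additive_function.nonneg_conflations (opcat C) lam = nonneg_conflations\<inverse>"
proof -
  interpret op: additive_function "opcat C" lam by (fact additive_function_opcat)
  show "op.nonneg_cat = opcat nonneg_cat"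
    by (simp add: op.nonneg_cat_def nonneg_cat_def full_subcategory_opcat)
  show "op.nonneg_conflations = nonneg_conflations\<inverse>"
    using short_exactD(7) by (auto simp: op.nonneg_conflations_iff nonneg_conflations_iff)
qed

lemma lam_zero:
  assumes "is_zero_object C Z"
  shows "lam Z = 0"
proof -
  have "Z \<in> Obj C" using assms by (simp add: is_zero_object_def)
  then show ?thesis using lam_additive[OF short_exact_Id[OF assms, of Z]] by simp
qed

lemma lam_biproduct: "is_biproduct C X Y S i j p q \<Longrightarrow> lam S = lam X + lam Y"
  using lam_additive[OF biproduct_short_exact, of X Y S i j p q] biproductD(5,6,15)[of X Y S i j p q]
  by metis

section \<open>The exact structure on the objects with nonnegative \<open>lam\<close>\<close>

lemma nonneg_additive: "additive_category nonneg_cat"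
proof -
  obtain Z where Z: "is_zero_object C Z" using zero_object by blast
  show ?thesis unfolding nonneg_cat_def
  proof (rule full_subcategory_additive[OF Z])
    show "Z \<in> {M \<in> Obj C. 0 \<le> lam M}"
      using Z lam_zero by (simp add: is_zero_object_def)
    fix X Y W i j p q
    assume "X \<in> {M \<in> Obj C. 0 \<le> lam M}" "Y \<in> {M \<in> Obj C. 0 \<le> lam M}" "is_biproduct C X Y W i j p q"
    then show "W \<in> {M \<in> Obj C. 0 \<le> lam M}"
      using lam_biproduct biproductD(3) by auto
  qed
qed

lemma nonneg_inflation_Id:
  assumes "X \<in> Obj nonneg_cat"
  shows "inflation nonneg_conflations (Id C X)"
proof -
  obtain Z where Z: "is_zero_object C Z" using zero_object by blast
  then have "Z \<in> Obj C" by (simp add: is_zero_object_def)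
  then have "(Id C X, Zero C X Z) \<in> nonneg_conflations"
    using short_exact_Id[OF Z, of X] assms lam_zero[OF Z] by (simp add: nonneg_conflations_iff)
  then show ?thesis by (auto simp: inflation_def)
qed

text \<open>The kernel is seen to lie in the subcategory by computing \<open>lam\<close>, so no nine lemma is needed.\<close>

lemma nonneg_deflation_comp:
  assumes "deflation nonneg_conflations g" "deflation nonneg_conflations h" "Cod C g = Dom C h"
  shows "deflation nonneg_conflations (h \<cdot> g)"
proof -
  obtain f e where fg: "(f, g) \<in> nonneg_conflations" and eh: "(e, h) \<in> nonneg_conflations"
    using assms by (auto simp: deflation_def)
  then have s: "short_exact C f g" "short_exact C e h" by (auto simp: nonneg_conflations_iff)
  note d = short_exactD[OF s(1)] short_exactD[OF s(2)]
  obtain k where k: "short_exact C k (h \<cdot> g)"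
    using epic_short_exact[OF epic_comp[OF d(12,4)]] assms(3) by auto
  have "(k, h \<cdot> g) \<in> nonneg_conflations"
    using k fg eh lam_additive[OF s(1)] lam_additive[OF s(2)] lam_additive[OF k] d assms(3)
      short_exactD(5-7)[OF k]
    by (simp add: nonneg_conflations_iff)
  then show ?thesis by (auto simp: deflation_def)
qed

text \<open>The pullback keeps the kernel, so \<open>lam\<close> of the pullback object is
  \<open>lam (Dom C f) + lam (Dom C a)\<close>, a sum of nonnegative numbers.\<close>

lemma nonneg_deflation_pullback:
  assumes "deflation nonneg_conflations g" "a \<in> Arr nonneg_cat" "Cod C a = Cod C g"
  shows "\<exists>b g'. is_pullback nonneg_cat g a b g' \<and> deflation nonneg_conflations g'"
proof -
  obtain f where fg: "(f, g) \<in> nonneg_conflations" using assms by (auto simp: deflation_def)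
  then have s: "short_exact C f g" by (auto simp: nonneg_conflations_iff)
  note d = short_exactD[OF s]
  obtain b g' where p: "is_pullback C g a b g'" "epic C g'"
    using epic_pullback[OF d(4), of a] assms by auto
  obtain f' where f': "is_kernel C f' g'" "Dom C f' = Dom C f" using pullback_kernel[OF d(1) p(1)] .
  have s': "short_exact C f' g'" using epic_cokernel_of_kernel p(2) f'(1) by blast
  note pd = pullbackD[OF p(1)]
  have lam: "0 \<le> lam (Dom C f)" "0 \<le> lam (Dom C g)" "0 \<le> lam (Cod C g)" "0 \<le> lam (Dom C a)"
    using fg d(7) assms(2) by (auto simp: nonneg_conflations_iff)
  then have lamf: "0 \<le> lam (Cod C f')"
    using lam_additive[OF s'] f'(2) pd(7) by simp
  have "(f', g') \<in> nonneg_conflations"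
    using s' f'(2) pd(7) lam lamf by (simp add: nonneg_conflations_iff)
  moreover have "is_pullback nonneg_cat g a b g'"
    unfolding nonneg_cat_def
    by (rule full_subcategory_pullback[OF p(1)])
      (use lam lamf short_exactD(7)[OF s'] pd in auto)
  ultimately show ?thesis by (auto simp: deflation_def)
qed

lemma nonneg_short_exact:
  assumes "(f, g) \<in> nonneg_conflations"
  shows "short_exact nonneg_cat f g"
proof -
  have se: "short_exact C f g" and lam: "0 \<le> lam (Dom C f)" "0 \<le> lam (Cod C f)" "0 \<le> lam (Cod C g)"
    using assms by (simp_all add: nonneg_conflations_iff)
  show ?thesis
    unfolding nonneg_cat_def
    using lam short_exactD(5,6)[OF se] by (intro full_subcategory_short_exact[OF se]) simp_all
qed

text \<open>Only exactness is transported along the isomorphisms; the bounds on \<open>lam\<close>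
  come with the new arrows, which already belong to the subcategory.\<close>

lemma nonneg_conflation_iso:
  assumes "(f, g) \<in> nonneg_conflations" "f' \<in> Hom nonneg_cat X' Y'" "g' \<in> Hom nonneg_cat Y' Z'"
    "a \<in> Hom nonneg_cat (Dom nonneg_cat f) X'" "b \<in> Hom nonneg_cat (Cod nonneg_cat f) Y'"
    "c \<in> Hom nonneg_cat (Cod nonneg_cat g) Z'"
    "is_iso nonneg_cat a" "is_iso nonneg_cat b" "is_iso nonneg_cat c"
    "b \<cdot>\<^bsub>nonneg_cat\<^esub> f = f' \<cdot>\<^bsub>nonneg_cat\<^esub> a" "c \<cdot>\<^bsub>nonneg_cat\<^esub> g = g' \<cdot>\<^bsub>nonneg_cat\<^esub> b"
  shows "(f', g') \<in> nonneg_conflations"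
proof -
  note iso = assms(7-9)[unfolded nonneg_cat_def, THEN full_subcategory_iso]
  have "short_exact C f' g'"
    by (rule short_exact_transport[OF _ iso, of f g])
      (use assms in \<open>simp_all add: nonneg_conflations_iff\<close>)
  then show ?thesis using assms(2,3) by (auto simp: nonneg_conflations_iff)
qed

lemmas nonneg_deflation_Id =
    additive_function.nonneg_inflation_Id[OF additive_function_opcat, unfolded opcat_nonneg, simplified]
  and nonneg_inflation_comp =
    additive_function.nonneg_deflation_comp[OF additive_function_opcat, unfolded opcat_nonneg, simplified]
  and nonneg_inflation_pushout =
    additive_function.nonneg_deflation_pullback[OF additive_function_opcat, unfolded opcat_nonneg, simplified]

theorem nonneg_exact: "exact_category nonneg_cat nonneg_conflations"
proof (intro exact_category.intro exact_category_axioms.intro)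
  show "additive_category nonneg_cat" by (fact nonneg_additive)
  show "short_exact nonneg_cat f g" if "(f, g) \<in> nonneg_conflations" for f g
    using that by (rule nonneg_short_exact)
  show "inflation nonneg_conflations (Id nonneg_cat X)" if "X \<in> Obj nonneg_cat" for X
    using nonneg_inflation_Id[OF that] by simp
  show "deflation nonneg_conflations (Id nonneg_cat X)" if "X \<in> Obj nonneg_cat" for X
    using nonneg_deflation_Id that by simp
  show "inflation nonneg_conflations (g \<cdot>\<^bsub>nonneg_cat\<^esub> f)"
    if "inflation nonneg_conflations f" "inflation nonneg_conflations g"
      "Cod nonneg_cat f = Dom nonneg_cat g" for f g
    using nonneg_inflation_comp that by simp
  show "deflation nonneg_conflations (g \<cdot>\<^bsub>nonneg_cat\<^esub> f)"
    if "deflation nonneg_conflations f" "deflation nonneg_conflations g"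
      "Cod nonneg_cat f = Dom nonneg_cat g" for f g
    using nonneg_deflation_comp that by simp
  show "\<exists>b f'. is_pushout nonneg_cat f a b f' \<and> inflation nonneg_conflations f'"
    if "inflation nonneg_conflations f" "a \<in> Arr nonneg_cat" "Dom nonneg_cat a = Dom nonneg_cat f" for f a
    using nonneg_inflation_pushout that by simp
  show "\<exists>b g'. is_pullback nonneg_cat g a b g' \<and> deflation nonneg_conflations g'"
    if "deflation nonneg_conflations g" "a \<in> Arr nonneg_cat" "Cod nonneg_cat a = Cod nonneg_cat g" for g a
    using nonneg_deflation_pullback that by simp
qed (rule nonneg_conflation_iso)

end

section \<open>Additive functions vanishing on projectives\<close>

lemma projectiveE:
  assumes "projective C P" "epic C g" "h \<in> Arr C" "Dom C h = P" "Cod C h = Cod C g"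
  obtains u where "u \<in> Arr C" "Dom C u = P" "Cod C u = Dom C g" "Comp C g u = h"
proof -
  have "h \<in> Hom C P (Cod C g)" using assms by simp
  then obtain u where "u \<in> Hom C P (Dom C g)" "Comp C g u = h"
    using assms(1,2) unfolding projective_def by blast
  then show thesis using that by auto
qed

lemma enough_projectivesE:
  assumes "enough_projectives C" "X \<in> Obj C"
  obtains P e where "projective C P" "epic C e" "e \<in> Arr C" "Dom C e = P" "Cod C e = X"
proof -
  obtain P e where "projective C P" "e \<in> Hom C P X" "epic C e"
    using assms unfolding enough_projectives_def by blast
  then show thesis using that by simp
qed

lemma (in preadditive_category) retract_projective:
  assumes P: "projective C P" and u: "u \<in> Arr C" "Dom C u = X" "Cod C u = P"
    and p: "p \<in> Arr C" "Dom C p = P" "Cod C p = X" "p \<cdot> u = Id C X"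
  shows "projective C X"
  unfolding projective_def
proof (intro conjI allI impI ballI)
  show "X \<in> Obj C" using u by auto
  fix g h assume g: "epic C g" and h: "h \<in> Hom C X (Cod C g)"
  then have ga: "g \<in> Arr C" by (simp add: epic_def)
  obtain v where v: "v \<in> Arr C" "Dom C v = P" "Cod C v = Dom C g" "g \<cdot> v = h \<cdot> p"
    by (rule projectiveE[OF P g, of "h \<cdot> p"]) (use h p in auto)
  have "g \<cdot> v \<cdot> u = h" using comp_reduce[OF v(4), of u] v u p h ga by simp
  then show "\<exists>u\<in>Hom C X (Dom C g). g \<cdot> u = h" using v u by (intro bexI[of _ "v \<cdot> u"]) auto
qed

text \<open>Test morphisms are precomposed with a projective presentation of their domain.\<close>

lemma (in abelian_category) full_subcategory_kernelD:
  assumes enough: "enough_projectives C" and S: "\<And>P. projective C P \<Longrightarrow> P \<in> S"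
    and k: "is_kernel (full_subcategory C S) k f"
  shows "is_kernel C k f"
proof -
  let ?F = "full_subcategory C S"
  interpret F: preadditive_category ?F by (fact full_subcategory_preadditive)
  note kd = F.kernelD[OF k, simplified]
  have cover: "\<exists>e. epic C e \<and> e \<in> Arr C \<and> projective C (Dom C e) \<and> Cod C e = X" if X: "X \<in> Obj C" for X
    using enough_projectivesE[OF enough X] by metis
  have mono_proj: "u = Zero C (Dom C u) (Dom C k)"
    if u: "u \<in> Arr C" "Cod C u = Dom C k" "projective C (Dom C u)" "k \<cdot> u = Zero C (Dom C u) (Cod C k)" for u
    using F.monic_cancel_Zero[OF F.kernel_monic[OF k], of u] u S kd by simp
  show ?thesis
  proof (rule kernelI)
    show "monic C k"
    proof (rule monicI)
      fix u assume u: "u \<in> Arr C" "Cod C u = Dom C k" "k \<cdot> u = Zero C (Dom C u) (Cod C k)"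
      obtain e where e: "epic C e" "e \<in> Arr C" "projective C (Dom C e)" "Cod C e = Dom C u"
        using cover[of "Dom C u"] u by auto
      have "u \<cdot> e = Zero C (Dom C (u \<cdot> e)) (Dom C k)"
        by (rule mono_proj) (use u e kd comp_reduce[OF u(3), of e] in auto)
      then show "u = Zero C (Dom C u) (Dom C k)"
        using epic_cancel_Zero[OF e(1), of u] u e by simp
    qed (use kd in simp)
    fix h assume h: "h \<in> Arr C" "Cod C h = Dom C f" "f \<cdot> h = Zero C (Dom C h) (Cod C f)"
    obtain e where e: "epic C e" "e \<in> Arr C" "projective C (Dom C e)" "Cod C e = Dom C h"
      using cover[of "Dom C h"] h by auto
    \<comment> \<open>To descend \<open>v\<close> along \<open>e\<close> one must see that it
      annihilates the kernel of \<open>e\<close>. That kernel may lie outside \<open>S\<close>,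
      where \<open>k\<close> cannot yet be cancelled, so a second projective cover \<open>n\<close>
      is placed in front of it.\<close>
    obtain m where m: "short_exact C m e" using epic_short_exact e by blast
    note md = short_exactD[OF m]
    obtain n where n: "epic C n" "n \<in> Arr C" "projective C (Dom C n)" "Cod C n = Dom C m"
      using cover[of "Dom C m"] md by auto
    obtain v where v: "v \<in> Arr C" "Dom C v = Dom C e" "Cod C v = Dom C k" "k \<cdot> v = h \<cdot> e"
      using F.kernelE[OF k, of "h \<cdot> e"] h e S kd comp_reduce[OF h(3), of e] by auto
    have "k \<cdot> v \<cdot> m \<cdot> n = h \<cdot> e \<cdot> m \<cdot> n"
      using comp_reduce[OF v(4), of "m \<cdot> n"] v h e md n kd by simp
    also have "\<dots> = Zero C (Dom C n) (Cod C k)"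
      using comp_reduce[OF md(8), of n] h e md(5-7) n kd by simp
    finally have "v \<cdot> m \<cdot> n = Zero C (Dom C (v \<cdot> m \<cdot> n)) (Dom C k)"
      by - (rule mono_proj, use v md n in auto)
    then have "v \<cdot> m = Zero C (Dom C m) (Cod C v)"
      using epic_cancel_Zero[OF n(1), of "v \<cdot> m"] v md n by simp
    then obtain w where w: "w \<in> Arr C" "Dom C w = Cod C e" "Cod C w = Cod C v" "w \<cdot> e = v"
      using cokernelE[OF md(2), of v] v md by auto
    have "(k \<cdot> w) \<cdot> e = h \<cdot> e" using w v e kd by simp
    then have "k \<cdot> w = h" using w v e h kd by - (rule epic_cancel[OF e(1)], auto)
    then show "\<exists>u. u \<in> Arr C \<and> Dom C u = Dom C h \<and> Cod C u = Dom C k \<and> k \<cdot> u = h"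
      using w v e by auto
  qed (use kd in auto)
qed

locale defect_function = additive_function +
  assumes enough: "enough_projectives C"
    and lam_projective: "projective C P \<Longrightarrow> lam P = 0"
    and lam_pos: "\<exists>S\<in>Obj C. 0 < lam S"
begin

section \<open>Projectives of the subcategory and the two failures\<close>

lemma lam_unbounded: "\<exists>T\<in>Obj C. int n \<le> lam T"
proof (induction n)
  case 0
  obtain S where "S \<in> Obj C" "0 < lam S" using lam_pos by blast
  then show ?case by (intro bexI[of _ S]) auto
next
  case (Suc n)
  then obtain T S where TS: "T \<in> Obj C" "int n \<le> lam T" "S \<in> Obj C" "0 < lam S"
    using lam_pos by blast
  \<comment> \<open>Since \<open>lam\<close> is integer-valued, each further copy of an object with
    positive \<open>lam\<close> adds at least one.\<close>
  obtain U i j p q where U: "is_biproduct C T S U i j p q" using biproducts TS by meson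
  show ?case using lam_biproduct[OF U] TS biproductD(3)[OF U] by (intro bexI[of _ U]) auto
qed

text \<open>Deflations of the subcategory are epimorphisms of \<open>C\<close>, and \<open>P\<close>
  belongs to the subcategory because \<open>lam P = 0\<close>; the lifts then stay inside by
  fullness.\<close>

lemma projective_exact_projective:
  assumes "projective C P"
  shows "P \<in> exact_projectives nonneg_cat nonneg_conflations"
proof (rule exact_category.projI[OF nonneg_exact])
  show "P \<in> Obj nonneg_cat" using assms lam_projective by (simp add: projective_def)
  fix f g h assume fg: "(f, g) \<in> nonneg_conflations" and h: "h \<in> Arr nonneg_cat" "Dom nonneg_cat h = P"
    "Cod nonneg_cat h = Cod nonneg_cat g"
  have se: "short_exact C f g" using fg by (simp add: nonneg_conflations_iff)
  note d = short_exactD[OF se]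
  obtain u where "u \<in> Arr C" "Dom C u = P" "Cod C u = Dom C g" "g \<cdot> u = h"
    by (rule projectiveE[OF assms d(4), of h]) (use h in auto)
  then show "\<exists>u. u \<in> Arr nonneg_cat \<and> Dom nonneg_cat u = P \<and> Cod nonneg_cat u = Dom nonneg_cat g \<and>
      g \<cdot>\<^bsub>nonneg_cat\<^esub> u = h"
    using fg d h by (auto simp: nonneg_conflations_iff)
qed

text \<open>The kernel of an epimorphism \<open>P \<rightarrow> X\<close> from a projective may leave the subcategory. Adding an
  object \<open>T\<close> with large \<open>lam\<close> repairs this, and \<open>P \<oplus> T \<rightarrow> P \<rightarrow> X\<close> still factors through \<open>P\<close>.\<close>

lemma projective_deflation:
  assumes X: "X \<in> Obj nonneg_cat"
  obtains f g P p q where "(f, g) \<in> nonneg_conflations" "Cod C g = X" "g = p \<cdot> q" "projective C P"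
    "p \<in> Arr C" "Dom C p = P" "Cod C p = X" "q \<in> Arr C" "Dom C q = Dom C g" "Cod C q = P"
proof -
  obtain P p where P: "projective C P" and p: "p \<in> Arr C" "Dom C p = P" "Cod C p = X" "epic C p"
    using enough_projectivesE[OF enough, of X] X by (metis nonneg_simps(1))
  obtain T where T: "T \<in> Obj C" "lam X \<le> lam T" using lam_unbounded[of "nat (lam X)"] X by auto
  obtain Y i j q r where Y: "is_biproduct C P T Y i j q r"
    using biproducts[of P T] P T by (auto simp: projective_def)
  note bd = biproductD[OF Y]
  have "epic C q" using retraction_epic[of q i] bd by simp
  then have "epic C (p \<cdot> q)" using epic_comp[OF p(4), of q] p bd by simp
  then obtain f where f: "short_exact C f (p \<cdot> q)" using epic_short_exact by blast
  note d = short_exactD[OF f]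
  have "(f, p \<cdot> q) \<in> nonneg_conflations"
    using f lam_additive[OF f] lam_biproduct[OF Y] lam_projective[OF P] X T p bd d
    by (simp add: nonneg_conflations_iff)
  then show thesis using that[of f "p \<cdot> q" p q P] P p bd by simp
qed

text \<open>Projectivity in the subcategory could be weaker, as it is tested only on epimorphisms
  with kernel inside. It suffices for the deflation \<open>p \<cdot> q\<close>: a section
  \<open>u\<close> turns \<open>q \<cdot> u\<close> into a section of \<open>p\<close>, so
  \<open>X\<close> is a retract of \<open>P\<close> and projective in \<open>C\<close>.\<close>

lemma lam_exact_projective:
  assumes X: "X \<in> exact_projectives nonneg_cat nonneg_conflations"
  shows "lam X = 0"
proof -
  have X': "X \<in> Obj nonneg_cat" using X by (simp add: exact_projectives_def)
  obtain f g P p q where g: "(f, g) \<in> nonneg_conflations" "Cod C g = X" "g = p \<cdot> q" "projective C P"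
    "p \<in> Arr C" "Dom C p = P" "Cod C p = X" "q \<in> Arr C" "Dom C q = Dom C g" "Cod C q = P"
    using projective_deflation[OF X'] .
  obtain u where u: "u \<in> Arr nonneg_cat" "Dom C u = X" "Cod C u = Dom C g" "g \<cdot> u = Id C X"
    using exact_category.projE[OF nonneg_exact X g(1), of "Id C X"] X' g(2) by auto
  have "(p \<cdot> q) \<cdot> u = Id C X" using u(4) unfolding g(3) .
  then have "p \<cdot> q \<cdot> u = Id C X" using u(1-3) g(5-10) by simp
  then have "projective C X"
    using u(1-3) g(5-10) by (intro retract_projective[OF g(4), of "q \<cdot> u" X p]) simp_all
  then show ?thesis by (rule lam_projective)
qed

lemma not_special_precovering:
  "\<not> special_precovering_pair nonneg_cat nonneg_conflations
      (exact_projectives nonneg_cat nonneg_conflations) (Obj nonneg_cat)"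
proof
  assume s: "special_precovering_pair nonneg_cat nonneg_conflations
      (exact_projectives nonneg_cat nonneg_conflations) (Obj nonneg_cat)"
  obtain S where S: "S \<in> Obj C" "0 < lam S" using lam_pos by blast
  then have "S \<in> Obj nonneg_cat" by simp
  then obtain f g where fg: "(f, g) \<in> nonneg_conflations" "Cod C g = S"
    "Dom C g \<in> exact_projectives nonneg_cat nonneg_conflations"
    using s unfolding special_precovering_pair_def by fastforce
  have se: "short_exact C f g" using fg by (simp add: nonneg_conflations_iff)
  show False using lam_additive[OF se] short_exactD(7)[OF se] lam_exact_projective[OF fg(3)] fg(1,2) S
    by (simp add: nonneg_conflations_iff)
qed

lemma not_weakly_idempotent_complete: "\<not> weakly_idempotent_complete nonneg_cat"
proof
  assume w: "weakly_idempotent_complete nonneg_cat"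
  obtain S where S: "S \<in> Obj C" "0 < lam S" using lam_pos by blast
  obtain P p where P: "projective C P" and p: "p \<in> Arr C" "Dom C p = P" "Cod C p = S" "epic C p"
    using enough_projectivesE[OF enough S(1)] by metis
  obtain k where k: "short_exact C k p" using epic_short_exact p by blast
  note d = short_exactD[OF k]
  have lamK: "lam (Dom C k) = - lam S" using lam_additive[OF k] d p lam_projective[OF P] by simp
  obtain Y i j q r where Y: "is_biproduct C S (Dom C k) Y i j q r"
    using biproducts[of S "Dom C k"] S d by auto
  note bd = biproductD[OF Y]
  \<comment> \<open>The summand \<open>Dom C k\<close> has negative \<open>lam\<close> and lies
    outside the subcategory, but the contribution of \<open>S\<close> cancels it, so
    \<open>Y\<close> and the retraction \<open>q\<close> lie inside.\<close>
  have lamY: "lam Y = 0" using lam_biproduct[OF Y] lamK by simp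
  have "retraction nonneg_cat q"
    using bd S lamY by (auto simp: retraction_def intro!: bexI[of _ i])
  then obtain l where "is_kernel nonneg_cat l q" using w by (auto simp: weakly_idempotent_complete_def)
  moreover have "0 \<le> lam (Dom C l)" using calculation by (auto simp: is_kernel_def)
  ultimately have l: "is_kernel C l q" "0 \<le> lam (Dom C l)"
    using full_subcategory_kernelD[OF enough, of "{M \<in> Obj C. 0 \<le> lam M}" l q] lam_projective
    by (auto simp: nonneg_cat_def projective_def)
  \<comment> \<open>Being epic, \<open>q\<close> forms a short exact sequence with any kernel in
    \<open>C\<close>. Additivity then forces \<open>lam (Dom C l)\<close> to be
    \<open>- lam S\<close>, without identifying \<open>l\<close> with the second injection.\<close>
  have "epic C q" using retraction_epic[of q i] bd by simp
  then have "short_exact C l q" using epic_cokernel_of_kernel l by blast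
  then show False using lam_additive[of l q] l(2) S lamY bd kernelD(3)[OF l(1)] by simp
qed

end

theorem theorem1:
  fixes B A :: "('o, 'm) precat" and E :: "('m \<times> 'm) set"
    and lam :: "'o \<Rightarrow> int" and \<P> :: "'o set"
  assumes abelian: "abelian_category B"
    and enough: "enough_projectives B"
    and lam_iso: "\<And>X Y. \<lbrakk>X \<in> Obj B; Y \<in> Obj B; isomorphic B X Y\<rbrakk> \<Longrightarrow> lam X = lam Y"
    and lam_additive: "\<And>f g. short_exact B f g \<Longrightarrow>
          lam (Cod B f) = lam (Dom B f) + lam (Cod B g)"
    and lam_projective: "\<And>P. projective B P \<Longrightarrow> lam P = 0"
    and lam_pos: "\<exists>S\<in>Obj B. lam S > 0"
    and A_def: "A = full_subcategory B {M \<in> Obj B. lam M \<ge> 0}"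
    and E_def: "E = induced_conflations B (Obj A)"
    and P_def: "\<P> = exact_projectives A E"
  shows "exact_category A E
    \<and> (complete_ideal_cotorsion_pair A E (ideal_of A \<P>) (ideal_of A (Obj A))
        \<and> object_ideal A (ideal_of A \<P>) \<and> object_ideal A (ideal_of A (Obj A)))
    \<and> ((ideal_objects A (ideal_of A \<P>), ideal_objects A (ideal_of A (Obj A))) = (\<P>, Obj A)
        \<and> cotorsion_pair A E \<P> (Obj A) \<and> \<not> complete_cotorsion_pair A E \<P> (Obj A))
    \<and> \<not> weakly_idempotent_complete A"
proof -
  interpret B: defect_function B lam
    by (intro defect_function.intro additive_function.intro abelian
        additive_function_axioms.intro defect_function_axioms.intro
        lam_additive enough lam_projective lam_pos)
  have A: "A = B.nonneg_cat" by (simp add: A_def B.nonneg_cat_def)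
  have E: "E = B.nonneg_conflations" by (simp add: E_def A B.nonneg_conflations_def)
  interpret A: exact_category A E unfolding A E by (rule B.nonneg_exact)
  have deflations: "\<exists>f g. (f, g) \<in> E \<and> Cod A g = X \<and> g \<in> ideal_of A \<P>" if X: "X \<in> Obj A" for X
  proof -
    obtain f g P p q where g: "(f, g) \<in> E" "Cod B g = X" "g = Comp B p q" "projective B P"
      "p \<in> Arr B" "Dom B p = P" "Cod B p = X" "q \<in> Arr B" "Dom B q = Dom B g" "Cod B q = P"
      using B.projective_deflation X unfolding A E by metis
    have P: "P \<in> \<P>" using B.projective_exact_projective g(4) by (simp add: P_def A E)
    have "short_exact A f g" using A.conflation_short_exact g(1) by blast
    then have "g \<in> Arr B.nonneg_cat" using A.short_exactD(6) A by blast
    \<comment> \<open>The factorization was found in \<open>B\<close>. It takes place in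
      \<open>A\<close> because the middle object \<open>P\<close> has \<open>lam\<close>
      zero.\<close>
    then have "q \<in> Arr B.nonneg_cat" "p \<in> Arr B.nonneg_cat"
      using g(2,5-10) X B.lam_projective[OF g(4)] by (auto simp: A)
    then have "Comp A p q \<in> ideal_of A \<P>"
      using g(6,10) P unfolding A by (intro ideal_ofI) simp_all
    moreover have "Comp A p q = g" "Cod A g = X" using g(2,3) unfolding A by simp_all
    ultimately show ?thesis using g(1) by metis
  qed
  note cot = A.proj_ideal_cotorsion[folded P_def, OF deflations]
  have "mor_ideal A (ideal_of A (Obj A))" by (auto simp: A.ideal_of_Obj mor_ideal_def)
  then have "object_ideal A (ideal_of A (Obj A))" by (rule A.object_ideal_ideal_of) simp
  moreover have "object_ideal A (ideal_of A \<P>)"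
    using A.object_ideal_ideal_of[OF A.mor_ideal_proj A.proj_Obj] by (simp add: P_def)
  moreover have "ideal_objects A (ideal_of A \<P>) = \<P>"
    using A.ideal_objects_proj_ideal by (simp add: P_def)
  moreover have "ideal_objects A (ideal_of A (Obj A)) = Obj A"
    by (auto simp: A.ideal_of_Obj ideal_objects_def)
  \<comment> \<open>Completeness breaks down at its precovering half.\<close>
  moreover have "\<not> complete_cotorsion_pair A E \<P> (Obj A)"
    using B.not_special_precovering by (simp add: complete_cotorsion_pair_def A E P_def)
  moreover have "\<not> weakly_idempotent_complete A"
    using B.not_weakly_idempotent_complete by (simp add: A)
  ultimately show ?thesis using cot A.exact_category_axioms by simp
qed

end
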